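(* Let $F:\mathcal{L}^2(\Omega,\mathscr{F},R^n)\to\mathcal{L}^2(\Omega,\mathscr{F},R^n)$ be monotone and Lipschitz continuous with constant $L_F>0$ (with respect to $\|\cdot\|_{\mathcal{L}^2}$), and assume that the solution set of the variational inequality $\mathrm{VI}(T,\mathcal{K})$ is nonempty. Let $\beta>0$, $r>\frac{L_F}{\beta}+1$ and $\alpha\in(0,1)$. Then, for any starting point $\theta^0=(x^0,y^0,\lambda^0)^\top\in\mathcal{C}\times\mathcal{N}\times\mathcal{L}^2(\Omega,\mathscr{F},R^n)$, the sequence $\{\theta^k\}_{k=0}^\infty$ generated by the prediction-correction ADMM converges weakly in $[\mathcal{L}^2(\Omega,\mathscr{F},R^n)]^3$ to some solution $\theta^*$ of $\mathrm{VI}(T,\mathcal{K})$.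
   Context: Let $(\Omega,\mathscr{F},P)$ be a complete probability space and let $\mathcal{L}^2(\Omega,\mathscr{F},R^n)$ be the Hilbert space of (a.s. equivalence classes of) square-integrable $\mathscr{F}$-measurable $R^n$-valued random vectors with inner product $\langle\xi,\eta\rangle_{\mathcal{L}^2}=\mathbb{E}\langle\xi,\eta\rangle$ and norm $\|\xi\|_{\mathcal{L}^2}$. Let $N\in\mathbb{N}$, let $\xi_j$ be $\mathscr{F}$-measurable $R^{m_j}$-valued random vectors ($j=1,\dots,N-1$), put $\mathscr{F}_0=\{\emptyset,\Omega\}$ and, for $1\le i\le N-1$, let $\mathscr{F}_i$ be the $\sigma$-field generated by $\xi_1,\dots,\xi_i$ together with all $P$-null sets. Let $n_0+\cdots+n_{N-1}=n$ with $n_i\in\mathbb{N}$, and write $x=(x_0,\dots,x_{N-1})$ with $x_i$ valued in $R^{n_i}$. The nonanticipativity subspace is $\mathcal{N}=\{x\in\mathcal{L}^2(\Omega,\mathscr{F},R^n): x_i \text{ is } \mathscr{F}_i\text{-measurable},\ i=0,\dots,N-1\}$, a closed linear subspace. Let $C_i:\Omega\rightsquigarrow R^{n_i}$ be $\mathscr{F}_i$-measurable set-valued maps with nonempty closed convex values, $i=0,\dots,N-1$ (measurable means $\{\omega: C_i(\omega)\cap A\ne\emptyset\}\in\mathscr{F}_i$ for every Borel $A\subset R^{n_i}$), and let $\mathcal{C}=\{x\in\mathcal{L}^2(\Omega,\mathscr{F},R^n): x_i(\omega)\in C_i(\omega)\text{ for a.s. }\omega\in\Omega,\ i=0,\dots,N-1\}$,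 a closed convex set. Let $\mathcal{K}=\mathcal{C}\times\mathcal{N}\times\mathcal{L}^2(\Omega,\mathscr{F},R^n)$ and, for $\theta=(x,y,\lambda)^\top\in[\mathcal{L}^2(\Omega,\mathscr{F},R^n)]^3$, let $T(\theta)=(F(x)-\lambda,\ \lambda,\ x-y)^\top$. $\mathrm{VI}(T,\mathcal{K})$ is the problem of finding $\theta^*\in\mathcal{K}$ such that $\langle T(\theta^* ),\theta-\theta^*\rangle_{\mathcal{L}^2}\ge 0$ for all $\theta\in\mathcal{K}$ (inner product on the product space, i.e. the sum of the componentwise inner products). $F$ is monotone if $\langle F(x)-F(y),x-y\rangle_{\mathcal{L}^2}\ge0$ for all $x,y$. $\Pi_{\mathcal{S}}$ denotes the metric projection onto a nonempty closed convex set $\mathcal{S}\subset\mathcal{L}^2(\Omega,\mathscr{F},R^n)$. Prediction-correction ADMM. Given $\beta,r>0$ with $r>\frac{L_F}{\beta}+1$, $\alpha\in(0,1)$ and $\theta^0=(x^0,y^0,\lambda^0)^\top\in\mathcal{C}\times\mathcal{N}\times\mathcal{L}^2(\Omega,\mathscr{F},R^n)$, for $k=0,1,2,\dots$ and $\theta^k=(x^k,y^k,\lambda^k)^\top$ compute the prediction $\tilde\theta^k=(\tilde x^k,\tilde y^k,\tilde\lambda^k)^\top$ by $$\tilde x^k=\Pi_{\mathcal{C}}\{x^k-\tfrac{1}{\beta r}[F(x^k)-\lambda^k+\beta(x^k-y^k)]\},$$ $$\tilde y^k=\Pi_{\mathcal{N}}\{y^k-\tfrac1\beta[\lambda^k-\beta(\tilde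 x^k-y^k)]\},\qquad \tilde\lambda^k=\lambda^k-\beta(\tilde x^k-\tilde y^k),$$ and then the correction $\theta^{k+1}=\theta^k-\alpha\, d(\theta^k,\tilde\theta^k,\zeta^k)$, where $\zeta^k=(\zeta_x^k,0,0)^\top$, $\zeta_x^k=F(x^k)-F(\tilde x^k)+\beta(x^k-\tilde x^k)$, $d(\theta^k,\tilde\theta^k,\zeta^k)=\theta^k-\tilde\theta^k-G^{-1}\zeta^k$, and $G(x,y,\lambda)^\top=(\beta r x,\ \beta y,\ \tfrac1\beta\lambda)^\top$ (so $G^{-1}(u,v,w)^\top=(\tfrac{1}{\beta r}u,\tfrac1\beta v,\beta w)^\top$). *)

theory Defs
  imports "HOL-Probability.Probability"
begin

text \<open>
  Elements of the Hilbert space are represented by functions, two functions that agree almost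
  everywhere standing for the same element. Every set and relation below respects that
  identification, and an operator that is Lipschitz for \<open>L2_norm\<close> does as well.
\<close>

definition L2 :: "'a measure \<Rightarrow> ('a \<Rightarrow> 'v::euclidean_space) set" where
  "L2 M = {x \<in> borel_measurable M. integrable M (\<lambda>\<omega>. (norm (x \<omega>))\<^sup>2)}"

definition L2_inner :: "'a measure \<Rightarrow> ('a \<Rightarrow> 'v::euclidean_space) \<Rightarrow> ('a \<Rightarrow> 'v) \<Rightarrow> real" where
  "L2_inner M x y = (\<integral>\<omega>. x \<omega> \<bullet> y \<omega> \<partial>M)"

definition L2_norm :: "'a measure \<Rightarrow> ('a \<Rightarrow> 'v::euclidean_space) \<Rightarrow> real" where
  "L2_norm M x = sqrt (L2_inner M x x)"

definition L2_monotone ::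
    "'a measure \<Rightarrow> (('a \<Rightarrow> 'v::euclidean_space) \<Rightarrow> ('a \<Rightarrow> 'v)) \<Rightarrow> bool" where
  "L2_monotone M F \<longleftrightarrow>
     (\<forall>x\<in>L2 M. \<forall>y\<in>L2 M. L2_inner M (\<lambda>\<omega>. F x \<omega> - F y \<omega>) (\<lambda>\<omega>. x \<omega> - y \<omega>) \<ge> 0)"

definition L2_lipschitz ::
    "'a measure \<Rightarrow> real \<Rightarrow> (('a \<Rightarrow> 'v::euclidean_space) \<Rightarrow> ('a \<Rightarrow> 'v)) \<Rightarrow> bool" where
  "L2_lipschitz M L F \<longleftrightarrow>
     (\<forall>x\<in>L2 M. \<forall>y\<in>L2 M.
        L2_norm M (\<lambda>\<omega>. F x \<omega> - F y \<omega>) \<le> L * L2_norm M (\<lambda>\<omega>. x \<omega> - y \<omega>))"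

text \<open>
  On a nonempty closed convex set the minimiser exists and is unique up to almost sure equality,
  so the choice operator only selects a representative.
\<close>

definition L2_proj ::
    "'a measure \<Rightarrow> ('a \<Rightarrow> 'v::euclidean_space) set \<Rightarrow> ('a \<Rightarrow> 'v) \<Rightarrow> ('a \<Rightarrow> 'v)" where
  "L2_proj M S z =
     (SOME p. p \<in> S \<and> (\<forall>s\<in>S. L2_norm M (\<lambda>\<omega>. z \<omega> - p \<omega>) \<le> L2_norm M (\<lambda>\<omega>. z \<omega> - s \<omega>)))"

type_synonym ('a, 'v) triple = "('a \<Rightarrow> 'v) \<times> ('a \<Rightarrow> 'v) \<times> ('a \<Rightarrow> 'v)"

fun diff3 :: "('a, 'v::euclidean_space) triple \<Rightarrow> ('a, 'v) triple \<Rightarrow> ('a, 'v) triple" where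
  "diff3 (x, y, l) (x', y', l') = (\<lambda>\<omega>. x \<omega> - x' \<omega>, \<lambda>\<omega>. y \<omega> - y' \<omega>, \<lambda>\<omega>. l \<omega> - l' \<omega>)"

fun scale3 :: "real \<Rightarrow> ('a, 'v::euclidean_space) triple \<Rightarrow> ('a, 'v) triple" where
  "scale3 c (x, y, l) = (\<lambda>\<omega>. c *\<^sub>R x \<omega>, \<lambda>\<omega>. c *\<^sub>R y \<omega>, \<lambda>\<omega>. c *\<^sub>R l \<omega>)"

fun inner3 ::
    "'a measure \<Rightarrow> ('a, 'v::euclidean_space) triple \<Rightarrow> ('a, 'v) triple \<Rightarrow> real" where
  "inner3 M (x, y, l) (x', y', l') = L2_inner M x x' + L2_inner M y y' + L2_inner M l l'"

definition weakly_converges3 ::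
    "'a measure \<Rightarrow> (nat \<Rightarrow> ('a, 'v::euclidean_space) triple) \<Rightarrow> ('a, 'v) triple \<Rightarrow> bool" where
  "weakly_converges3 M \<theta> \<theta>' \<longleftrightarrow>
     (\<forall>k. \<theta> k \<in> L2 M \<times> L2 M \<times> L2 M) \<and> \<theta>' \<in> L2 M \<times> L2 M \<times> L2 M \<and>
     (\<forall>\<eta>\<in>L2 M \<times> L2 M \<times> L2 M. (\<lambda>k. inner3 M (\<theta> k) \<eta>) \<longlonglongrightarrow> inner3 M \<theta>' \<eta>)"

definition VI_solution ::
    "'a measure \<Rightarrow> (('a, 'v::euclidean_space) triple \<Rightarrow> ('a, 'v) triple)
      \<Rightarrow> ('a, 'v) triple set \<Rightarrow> ('a, 'v) triple \<Rightarrow> bool" where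
  "VI_solution M T K \<theta>' \<longleftrightarrow> \<theta>' \<in> K \<and> (\<forall>\<theta>\<in>K. inner3 M (T \<theta>') (diff3 \<theta> \<theta>') \<ge> 0)"

text \<open>
  \<open>\<xi> j\<close> takes values in \<open>Pi\<^sub>M {..<m j} (\<lambda>_. borel)\<close>, which is the library's rendering of the Borel
  space of real vectors of length \<open>m j\<close> when the length is not a type.
\<close>

definition stage_field ::
    "'a measure \<Rightarrow> (nat \<Rightarrow> nat) \<Rightarrow> (nat \<Rightarrow> 'a \<Rightarrow> nat \<Rightarrow> real) \<Rightarrow> nat \<Rightarrow> 'a measure" where
  "stage_field M m \<xi> i =
     (if i = 0 then sigma (space M) {}
      else sigma (space M)
        ((\<Union>j\<in>{1..i}. sets (vimage_algebra (space M) (\<xi> j) (Pi\<^sub>M {..<m j} (\<lambda>_. borel))))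
          \<union> null_sets M))"

text \<open>
  The splitting of an \<open>n\<close>-vector into stages is given by \<open>stg\<close>, which assigns to each coordinate
  its stage, so that \<open>n\<^sub>i\<close> is the number of coordinates of stage \<open>i\<close>. The space of stage-\<open>i\<close>
  vectors is identified with the vectors whose coordinates outside stage \<open>i\<close> vanish.
\<close>

definition stage_space :: "('n::finite \<Rightarrow> nat) \<Rightarrow> nat \<Rightarrow> (real^'n) set" where
  "stage_space stg i = {v. \<forall>c. stg c \<noteq> i \<longrightarrow> v $ c = 0}"

definition stage_part :: "('n::finite \<Rightarrow> nat) \<Rightarrow> nat \<Rightarrow> real^'n \<Rightarrow> real^'n" where
  "stage_part stg i v = (\<chi> c. if stg c = i then v $ c else 0)"

text \<open>
  A class of random vectors is measurable for a sub-\<open>\<sigma>\<close>-field if it has a measurable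
  representative; the distinction matters for stage \<open>0\<close>, whose trivial field lacks the null sets.
\<close>

definition nonanticipative ::
    "'a measure \<Rightarrow> (nat \<Rightarrow> nat) \<Rightarrow> (nat \<Rightarrow> 'a \<Rightarrow> nat \<Rightarrow> real) \<Rightarrow> nat \<Rightarrow> ('n::finite \<Rightarrow> nat)
      \<Rightarrow> ('a \<Rightarrow> real^'n) set" where
  "nonanticipative M m \<xi> N stg =
     {x \<in> L2 M. \<forall>i<N. \<exists>y \<in> borel_measurable (stage_field M m \<xi> i).
        AE \<omega> in M. stage_part stg i (x \<omega>) = y \<omega>}"

definition measurable_set_map ::
    "'a measure \<Rightarrow> ('n::finite \<Rightarrow> nat) \<Rightarrow> nat \<Rightarrow> ('a \<Rightarrow> (real^'n) set) \<Rightarrow> bool" where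
  "measurable_set_map A stg i C \<longleftrightarrow>
     (\<forall>B\<in>sets borel. B \<subseteq> stage_space stg i \<longrightarrow> {\<omega> \<in> space A. C \<omega> \<inter> B \<noteq> {}} \<in> sets A)"

definition constraint_set ::
    "'a measure \<Rightarrow> nat \<Rightarrow> ('n::finite \<Rightarrow> nat) \<Rightarrow> (nat \<Rightarrow> 'a \<Rightarrow> (real^'n) set)
      \<Rightarrow> ('a \<Rightarrow> real^'n) set" where
  "constraint_set M N stg C =
     {x \<in> L2 M. \<forall>i<N. AE \<omega> in M. stage_part stg i (x \<omega>) \<in> C i \<omega>}"

fun VI_operator ::
    "(('a \<Rightarrow> 'v::euclidean_space) \<Rightarrow> ('a \<Rightarrow> 'v)) \<Rightarrow> ('a, 'v) triple \<Rightarrow> ('a, 'v) triple" where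
  "VI_operator F (x, y, l) = (\<lambda>\<omega>. F x \<omega> - l \<omega>, l, \<lambda>\<omega>. x \<omega> - y \<omega>)"

fun prediction ::
    "'a measure \<Rightarrow> (('a \<Rightarrow> 'v::euclidean_space) \<Rightarrow> ('a \<Rightarrow> 'v)) \<Rightarrow> ('a \<Rightarrow> 'v) set \<Rightarrow> ('a \<Rightarrow> 'v) set
      \<Rightarrow> real \<Rightarrow> real \<Rightarrow> ('a, 'v) triple \<Rightarrow> ('a, 'v) triple" where
  "prediction M F CC NN \<beta> r (x, y, l) =
     (let xt = L2_proj M CC
                 (\<lambda>\<omega>. x \<omega> - (1 / (\<beta> * r)) *\<^sub>R (F x \<omega> - l \<omega> + \<beta> *\<^sub>R (x \<omega> - y \<omega>)));
          yt = L2_proj M NN (\<lambda>\<omega>. y \<omega> - (1 / \<beta>) *\<^sub>R (l \<omega> - \<beta> *\<^sub>R (xt \<omega> - y \<omega>)));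
          lt = (\<lambda>\<omega>. l \<omega> - \<beta> *\<^sub>R (xt \<omega> - yt \<omega>))
      in (xt, yt, lt))"

fun G_inv :: "real \<Rightarrow> real \<Rightarrow> ('a, 'v::euclidean_space) triple \<Rightarrow> ('a, 'v) triple" where
  "G_inv \<beta> r (u, v, w) = (\<lambda>\<omega>. (1 / (\<beta> * r)) *\<^sub>R u \<omega>, \<lambda>\<omega>. (1 / \<beta>) *\<^sub>R v \<omega>, \<lambda>\<omega>. \<beta> *\<^sub>R w \<omega>)"

fun zeta ::
    "(('a \<Rightarrow> 'v::euclidean_space) \<Rightarrow> ('a \<Rightarrow> 'v)) \<Rightarrow> real
      \<Rightarrow> ('a, 'v) triple \<Rightarrow> ('a, 'v) triple \<Rightarrow> ('a, 'v) triple" where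
  "zeta F \<beta> (x, y, l) (xt, yt, lt) =
     (\<lambda>\<omega>. F x \<omega> - F xt \<omega> + \<beta> *\<^sub>R (x \<omega> - xt \<omega>), \<lambda>_. 0, \<lambda>_. 0)"

definition direction ::
    "real \<Rightarrow> real \<Rightarrow> ('a, 'v::euclidean_space) triple \<Rightarrow> ('a, 'v) triple \<Rightarrow> ('a, 'v) triple
      \<Rightarrow> ('a, 'v) triple" where
  "direction \<beta> r \<theta> \<theta>t z = diff3 (diff3 \<theta> \<theta>t) (G_inv \<beta> r z)"

primrec ADMM ::
    "'a measure \<Rightarrow> (('a \<Rightarrow> 'v::euclidean_space) \<Rightarrow> ('a \<Rightarrow> 'v)) \<Rightarrow> ('a \<Rightarrow> 'v) set \<Rightarrow> ('a \<Rightarrow> 'v) set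
      \<Rightarrow> real \<Rightarrow> real \<Rightarrow> real \<Rightarrow> ('a, 'v) triple \<Rightarrow> nat \<Rightarrow> ('a, 'v) triple" where
  "ADMM M F CC NN \<beta> r \<alpha> \<theta>0 0 = \<theta>0"
| "ADMM M F CC NN \<beta> r \<alpha> \<theta>0 (Suc k) =
     (let \<theta> = ADMM M F CC NN \<beta> r \<alpha> \<theta>0 k;
          \<theta>t = prediction M F CC NN \<beta> r \<theta>
      in diff3 \<theta> (scale3 \<alpha> (direction \<beta> r \<theta> \<theta>t (zeta F \<beta> \<theta> \<theta>t))))"

end

theory Submission
  imports Defs "HOL-Library.Function_Algebras"
begin

text \<open>
  Let \<open>d\<close> be the correction direction at \<open>\<theta>\<close>. Adding the variational inequalities of the two projections
  gives that of \<open>VI(T, K)\<close> at the prediction, up to a residual controlled by the prediction error. Testing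
  it with a solution \<open>\<theta>*\<close> and using monotonicity yields \<open>2 \<langle>G d, \<theta> - \<theta>*\<rangle> \<ge> \<langle>G d, d\<rangle>\<close>, where the condition
  on \<open>r\<close> enters through
  \<open>\<parallel>\<zeta>\<parallel> \<le> (L + \<beta>) \<parallel>x - xt\<parallel> < \<beta> r \<parallel>x - xt\<parallel>\<close>. Hence the iterates are Fejer monotone in the \<open>G\<close>-norm and
  \<open>d\<close>, and with it the prediction error, tends to zero. The inequality at the prediction then passes to
  weak limits in Minty's form, so weak cluster points are solutions, and Opial's argument shows
  that there is only one.
\<close>

section \<open>Complete semi-inner product spaces\<close>

text \<open>The obstacle is that \<open>F\<close> is only norm continuous: along a weakly convergent
  sequence of predictions nothing is known about the limit of \<open>F xt\<close> or of its products
  with \<open>xt\<close>. Monotonicity therefore moves the operator to a fixed test point first;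
  there the inequality is affine in the predictions, and only the residual has to vanish in norm.
  The linear part of \<open>T\<close> is skew, so it drops out of every such estimate and the
  \<open>F\<close> term alone matters. The \<open>G\<close>-norm comes from the shape of the
  residual. The inequality at the prediction has the residual (\<beta> r ex - \<zeta> + \<beta> ey,
  0, el / \<beta>), where ex, ey, el are the prediction errors, and \<open>G d\<close> is (\<beta> r
  ex - \<zeta>, \<beta> ey, el / \<beta>). Up to the place of \<beta> ey, the correction thus moves
  along the residual measured in the \<open>G\<close> geometry. The step length \<alpha> leaves a
  decrease of \<alpha> (1 - \<alpha>) times the squared norm of \<open>d\<close>. A small
  \<open>d\<close> bounds only ex - \<zeta> / (\<beta> r) in the first component; the strict bound
  on \<open>r\<close> makes \<zeta> / (\<beta> r) a proper fraction of ex and so recovers ex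
  itself.\<close>

lemma nonneg_if_quadratic_nonneg:
  fixes a b :: real
  assumes "\<And>t. 0 < t \<Longrightarrow> t \<le> 1 \<Longrightarrow> 0 \<le> t * a + t\<^sup>2 * b"
  shows "0 \<le> a"
proof -
  have "0 \<le> a + t * b" if "0 < t" "t \<le> 1" for t
  proof -
    have "0 \<le> t * (a + t * b)"
      using assms[OF that] by (simp add: algebra_simps power2_eq_square)
    then show ?thesis
      using that by (simp add: zero_le_mult_iff)
  qed
  then have "eventually (\<lambda>t. 0 \<le> a + t * b) (at_right 0)"
    by (subst eventually_at_right[of 0 1]) (auto intro!: exI[of _ 1])
  moreover have "((\<lambda>t. a + t * b) \<longlongrightarrow> a + 0 * b) (at_right 0)"
    by (intro tendsto_intros)
  ultimately show ?thesis
    using tendsto_lowerbound[of "\<lambda>t. a + t * b" "a + 0 * b" "at_right 0" 0] by simp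
qed

text \<open>
  The form \<open>ip\<close> is only semidefinite, because vectors will be representatives of almost sure
  equivalence classes; a set that is \<open>closed_convex\<close> is automatically a union of such classes.
\<close>

locale semi_hilbert =
  fixes V :: "'v::real_vector set" and ip :: "'v \<Rightarrow> 'v \<Rightarrow> real"
  assumes subspace_V: "subspace V"
    and ip_commute: "x \<in> V \<Longrightarrow> y \<in> V \<Longrightarrow> ip x y = ip y x"
    and ip_add_left: "x \<in> V \<Longrightarrow> y \<in> V \<Longrightarrow> z \<in> V \<Longrightarrow> ip (x + y) z = ip x z + ip y z"
    and ip_scale_left: "x \<in> V \<Longrightarrow> z \<in> V \<Longrightarrow> ip (c *\<^sub>R x) z = c * ip x z"
    and ip_nonneg: "x \<in> V \<Longrightarrow> 0 \<le> ip x x"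
    and ip_complete:
      "\<lbrakk>\<And>n::nat. X n \<in> V; \<And>e. 0 < e \<Longrightarrow> \<exists>k. \<forall>m\<ge>k. \<forall>n\<ge>k. ip (X m - X n) (X m - X n) < e\<rbrakk>
        \<Longrightarrow> \<exists>x\<in>V. (\<lambda>n. ip (X n - x) (X n - x)) \<longlonglongrightarrow> 0"
begin

definition nrm :: "'v \<Rightarrow> real" where
  "nrm x = sqrt (ip x x)"

definition closed_convex :: "'v set \<Rightarrow> bool" where
  "closed_convex S \<longleftrightarrow> S \<subseteq> V \<and> convex S \<and>
     (\<forall>X x. (\<forall>n::nat. X n \<in> S) \<longrightarrow> x \<in> V \<longrightarrow> (\<lambda>n. nrm (X n - x)) \<longlonglongrightarrow> 0 \<longrightarrow> x \<in> S)"

text \<open>The selecting predicate is that of \<open>L2_proj\<close>, so that the two operators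
  pick the same representative.\<close>

definition proj :: "'v set \<Rightarrow> 'v \<Rightarrow> 'v" where
  "proj S z = (SOME p. p \<in> S \<and> (\<forall>s\<in>S. nrm (z - p) \<le> nrm (z - s)))"

text \<open>The filter is a parameter so that weak cluster points are weak limits along a finer
  filter.\<close>

definition wconv :: "(nat \<Rightarrow> 'v) \<Rightarrow> 'v \<Rightarrow> nat filter \<Rightarrow> bool" where
  "wconv u x H \<longleftrightarrow> (\<forall>z\<in>V. ((\<lambda>k. ip (u k) z) \<longlongrightarrow> ip x z) H)"

lemma closed_convexD:
  assumes "closed_convex S" "\<And>n::nat. X n \<in> S" "x \<in> V" "(\<lambda>n. nrm (X n - x)) \<longlonglongrightarrow> 0"
  shows "x \<in> S"
  using assms unfolding closed_convex_def by blast

lemma V_zero [simp]: "0 \<in> V"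
  and V_add [simp]: "x \<in> V \<Longrightarrow> y \<in> V \<Longrightarrow> x + y \<in> V"
  and V_scale [simp]: "x \<in> V \<Longrightarrow> c *\<^sub>R x \<in> V"
  and V_diff [simp]: "x \<in> V \<Longrightarrow> y \<in> V \<Longrightarrow> x - y \<in> V"
  and V_minus [simp]: "x \<in> V \<Longrightarrow> - x \<in> V"
  using subspace_V by (auto simp: subspace_0 subspace_add subspace_scale subspace_diff subspace_neg)

lemma ip_diff_left: "x \<in> V \<Longrightarrow> y \<in> V \<Longrightarrow> z \<in> V \<Longrightarrow> ip (x - y) z = ip x z - ip y z"
  using ip_add_left[of "x - y" y z] by simp

lemma ip_add_right: "x \<in> V \<Longrightarrow> y \<in> V \<Longrightarrow> z \<in> V \<Longrightarrow> ip z (x + y) = ip z x + ip z y"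
  using ip_add_left[of x y z] by (simp add: ip_commute[of z])

lemma ip_diff_right: "x \<in> V \<Longrightarrow> y \<in> V \<Longrightarrow> z \<in> V \<Longrightarrow> ip z (x - y) = ip z x - ip z y"
  using ip_diff_left[of x y z] by (simp add: ip_commute[of z])

lemma ip_scale_right: "x \<in> V \<Longrightarrow> z \<in> V \<Longrightarrow> ip z (c *\<^sub>R x) = c * ip z x"
  using ip_scale_left[of x z c] by (simp add: ip_commute[of z])

lemma ip_minus_left: "x \<in> V \<Longrightarrow> z \<in> V \<Longrightarrow> ip (- x) z = - ip x z"
  using ip_scale_left[of x z "-1"] by simp

lemma ip_minus_right: "x \<in> V \<Longrightarrow> z \<in> V \<Longrightarrow> ip z (- x) = - ip z x"
  using ip_scale_right[of x z "-1"] by simp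

lemma ip_zero_left [simp]: "z \<in> V \<Longrightarrow> ip 0 z = 0"
  using ip_scale_left[of 0 z 0] by simp

lemma ip_zero_right [simp]: "z \<in> V \<Longrightarrow> ip z 0 = 0"
  using ip_scale_right[of 0 z 0] by simp

lemmas ip_expand = ip_add_left ip_add_right ip_diff_left ip_diff_right ip_scale_left
  ip_scale_right ip_minus_left ip_minus_right

lemma ip_diff_scale_self:
  "a \<in> V \<Longrightarrow> b \<in> V \<Longrightarrow> ip (a - c *\<^sub>R b) (a - c *\<^sub>R b) = ip a a - c * (2 * ip b a) + c\<^sup>2 * ip b b"
  by (simp add: ip_expand ip_commute[of a b] power2_eq_square algebra_simps)

lemma nrm_nonneg [simp]: "x \<in> V \<Longrightarrow> 0 \<le> nrm x"
  by (simp add: nrm_def ip_nonneg)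

lemma nrm_power2: "x \<in> V \<Longrightarrow> (nrm x)\<^sup>2 = ip x x"
  by (simp add: nrm_def ip_nonneg)

lemma nrm_scale: "x \<in> V \<Longrightarrow> nrm (c *\<^sub>R x) = \<bar>c\<bar> * nrm x"
  by (simp add: nrm_def ip_expand real_sqrt_mult flip: mult.assoc power2_eq_square)

lemma Cauchy_Schwarz:
  assumes x: "x \<in> V" and y: "y \<in> V"
  shows "\<bar>ip x y\<bar> \<le> nrm x * nrm y"
proof -
  have q: "0 \<le> ip x x - 2 * t * ip x y + t\<^sup>2 * ip y y" for t
    using ip_nonneg[of "x - t *\<^sub>R y"] x y by (simp add: ip_diff_scale_self ip_commute[of y x])
  have "(ip x y)\<^sup>2 \<le> ip x x * ip y y"
  proof (cases "ip y y = 0")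
    case True
    show ?thesis
    proof (rule ccontr)
      assume "\<not> ?thesis"
      then have "ip x y \<noteq> 0"
        using True by auto
      \<comment> \<open>With \<open>ip y y = 0\<close> the quadratic in \<open>q\<close> is affine
        in \<open>t\<close>; the chosen \<open>t\<close> gives it the value -1.\<close>
      then show False
        using q[of "(ip x x + 1) / (2 * ip x y)"] True by (simp add: field_simps)
    qed
  next
    case False
    then have "0 < ip y y"
      using ip_nonneg[OF y] by simp
    then show ?thesis
      using q[of "ip x y / ip y y"] by (simp add: field_simps power2_eq_square)
  qed
  then have "sqrt ((ip x y)\<^sup>2) \<le> sqrt (ip x x * ip y y)"
    by (rule real_sqrt_le_mono)
  then show ?thesis
    by (simp add: nrm_def real_sqrt_mult)
qed

lemma nrm_triangle:
  assumes "x \<in> V" "y \<in> V"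
  shows "nrm (x + y) \<le> nrm x + nrm y"
proof (rule power2_le_imp_le)
  have "(nrm (x + y))\<^sup>2 = (nrm x)\<^sup>2 + 2 * ip x y + (nrm y)\<^sup>2"
    using assms by (simp add: nrm_power2 ip_expand ip_commute[of y x])
  then show "(nrm (x + y))\<^sup>2 \<le> (nrm x + nrm y)\<^sup>2"
    using Cauchy_Schwarz[OF assms] by (simp add: power2_sum)
qed (use assms in simp)

lemma nrm_triangle_diff: "x \<in> V \<Longrightarrow> y \<in> V \<Longrightarrow> nrm (x - y) \<le> nrm x + nrm y"
  using nrm_triangle[of x "- y"] nrm_scale[of y "-1"] by simp

text \<open>Substitute for definiteness: a vector of norm zero need not be zero, but the form cannot
  see it.\<close>

lemma ip_null: "x \<in> V \<Longrightarrow> y \<in> V \<Longrightarrow> ip x x = 0 \<Longrightarrow> ip x y = 0"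
  using Cauchy_Schwarz[of x y] by (simp add: nrm_def)

lemma tendsto_ip_null:
  assumes u: "\<And>k. u k \<in> V" and g: "\<And>k. g k \<in> V" and B: "\<And>k. nrm (u k) \<le> B"
    and lim: "((\<lambda>k. nrm (g k)) \<longlongrightarrow> 0) H"
  shows "((\<lambda>k. ip (u k) (g k)) \<longlongrightarrow> 0) H"
proof (rule tendsto_rabs_zero_cancel, rule tendsto_sandwich[OF _ _ tendsto_const])
  show "\<forall>\<^sub>F k in H. \<bar>ip (u k) (g k)\<bar> \<le> B * nrm (g k)"
  proof (intro always_eventually allI)
    fix k
    show "\<bar>ip (u k) (g k)\<bar> \<le> B * nrm (g k)"
      using Cauchy_Schwarz[OF u g, of k k] mult_right_mono[OF B nrm_nonneg[OF g], of k k] by simp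
  qed
  show "((\<lambda>k. B * nrm (g k)) \<longlongrightarrow> 0) H"
    using tendsto_mult_left[OF lim, of B] by simp
qed simp

text \<open>Carries weak limits over from the iterates to the predictions.\<close>

lemma wconv_perturb:
  assumes u: "\<And>k. u k \<in> V" and v: "\<And>k. v k \<in> V"
    and w: "wconv u x H" and lim: "((\<lambda>k. nrm (u k - v k)) \<longlongrightarrow> 0) H"
  shows "wconv v x H"
  unfolding wconv_def
proof
  fix z
  assume z: "z \<in> V"
  have "((\<lambda>k. ip z (u k - v k)) \<longlongrightarrow> 0) H"
    by (rule tendsto_ip_null[OF _ _ _ lim, of "\<lambda>_. z" "nrm z"]) (use u v z in auto)
  moreover have "((\<lambda>k. ip (u k) z) \<longlongrightarrow> ip x z) H"
    using w z by (simp add: wconv_def)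
  ultimately have "((\<lambda>k. ip (u k) z - ip z (u k - v k)) \<longlongrightarrow> ip x z - 0) H"
    by (intro tendsto_diff)
  then show "((\<lambda>k. ip (v k) z) \<longlongrightarrow> ip x z) H"
    using u v z by (simp add: ip_expand ip_commute[of z])
qed

section \<open>Projections and the Riesz representation\<close>

lemma quadratic_functional_min:
  assumes S: "closed_convex S" "S \<noteq> {}"
    and add: "\<And>x y. x \<in> V \<Longrightarrow> y \<in> V \<Longrightarrow> \<phi> (x + y) = \<phi> x + \<phi> y"
    and scale: "\<And>c x. x \<in> V \<Longrightarrow> \<phi> (c *\<^sub>R x) = c * \<phi> x"
    and bd: "\<And>x. x \<in> V \<Longrightarrow> \<bar>\<phi> x\<bar> \<le> B * nrm x"
  shows "\<exists>p\<in>S. \<forall>s\<in>S. ip p (s - p) \<ge> \<phi> (s - p) \<and> ip p p - 2 * \<phi> p \<le> ip s s - 2 * \<phi> s"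
proof -
  \<comment> \<open>One minimisation serves two purposes: \<open>\<phi> = ip z\<close> gives the
    projection of \<open>z\<close> onto \<open>S\<close>, and \<open>S = V\<close> gives the Riesz
    representative of \<open>\<phi>\<close>. \<open>J\<close> is bounded below because
    \<open>J x\<close> is at least \<open>(nrm x - B)\<^sup>2 - B\<^sup>2\<close>.\<close>
  define J where "J x = ip x x - 2 * \<phi> x" for x
  have SV: "x \<in> V" if "x \<in> S" for x
    using S that by (auto simp: closed_convex_def)
  have comb: "(1 - t) *\<^sub>R a + t *\<^sub>R b \<in> S" if "a \<in> S" "b \<in> S" "0 \<le> t" "t \<le> 1" for a b t
    using S that by (auto simp: closed_convex_def convex_alt)
  have diff: "\<phi> (x - y) = \<phi> x - \<phi> y" if "x \<in> V" "y \<in> V" for x y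
    using add[of "x - y" y] that by simp
  have "- B\<^sup>2 \<le> J x" if "x \<in> V" for x
  proof -
    have "0 \<le> (nrm x - B)\<^sup>2"
      by simp
    then show ?thesis
      using bd[OF that] nrm_power2[OF that]
      by (simp add: J_def power2_diff mult.commute)
  qed
  then have bdd: "bdd_below (J ` S)"
    using SV by (intro bdd_belowI2) auto
  define m where "m = Inf (J ` S)"
  have m: "m \<le> J x" if "x \<in> S" for x
    unfolding m_def using bdd that by (simp add: cINF_lower)
  have "\<exists>x\<in>S. J x < m + 1 / real (Suc n)" for n
  proof -
    have "Inf (J ` S) < m + 1 / real (Suc n)"
      by (simp add: m_def)
    then show ?thesis
      using S(2) by (subst (asm) cInf_less_iff) (use bdd in auto)
  qed
  then obtain X where X: "\<And>n. X n \<in> S" "\<And>n. J (X n) < m + 1 / real (Suc n)"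
    by metis
  have XV: "X n \<in> V" for n
    using X SV by blast
  \<comment> \<open>Parallelogram law: at the midpoint \<open>J\<close> equals the mean of
    \<open>J a\<close> and \<open>J b\<close> minus a quarter of the squared distance, and this is
    still at least \<open>m\<close>. Minimising sequences are therefore Cauchy.\<close>
  have par: "ip (a - b) (a - b) \<le> 2 * (J a - m) + 2 * (J b - m)" if "a \<in> S" "b \<in> S" for a b
  proof -
    have V: "a \<in> V" "b \<in> V"
      using that SV by auto
    have "m \<le> J ((1 - 1/2) *\<^sub>R a + (1/2) *\<^sub>R b)"
      using that by (intro m comb) auto
    then show ?thesis
      using V by (simp add: J_def ip_expand ip_commute[of b a] add scale algebra_simps)
  qed
  have "\<exists>x\<in>V. (\<lambda>n. ip (X n - x) (X n - x)) \<longlonglongrightarrow> 0"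
  proof (rule ip_complete[OF XV])
    fix e :: real
    assume "0 < e"
    then obtain k where k: "1 / real (Suc k) < e / 4"
      using nat_approx_posE[of "e / 4"] by auto
    have Jk: "J (X n) - m < e / 4" if "n \<ge> k" for n
    proof -
      have "1 / real (Suc n) \<le> 1 / real (Suc k)"
        using that by (simp add: frac_le)
      then show ?thesis
        using X(2)[of n] k by linarith
    qed
    then have "ip (X i - X j) (X i - X j) < e" if "i \<ge> k" "j \<ge> k" for i j
      using par[OF X(1) X(1), of i j] that(1)[THEN Jk] that(2)[THEN Jk] by argo
    then show "\<exists>k. \<forall>m\<ge>k. \<forall>n\<ge>k. ip (X m - X n) (X m - X n) < e"
      by blast
  qed
  then obtain p where p: "p \<in> V" and lim: "(\<lambda>n. ip (X n - p) (X n - p)) \<longlonglongrightarrow> 0"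
    by blast
  have nlim: "(\<lambda>n. nrm (X n - p)) \<longlonglongrightarrow> 0"
    unfolding nrm_def using tendsto_real_sqrt[OF lim] by simp
  have pS: "p \<in> S"
    by (rule closed_convexD[OF S(1) X(1) p nlim])
  have "(\<lambda>n. \<phi> (X n - p)) \<longlonglongrightarrow> 0"
  proof (rule tendsto_rabs_zero_cancel, rule tendsto_sandwich[OF _ _ tendsto_const])
    show "(\<lambda>n. B * nrm (X n - p)) \<longlonglongrightarrow> 0"
      using tendsto_mult_left[OF nlim, of B] by simp
  qed (use bd XV p in auto)
  moreover have "(\<lambda>n. ip p (X n - p)) \<longlonglongrightarrow> 0"
    by (rule tendsto_ip_null[OF _ _ _ nlim, of "\<lambda>_. p" "nrm p"]) (use XV p in auto)
  ultimately have "(\<lambda>n. J p + (ip (X n - p) (X n - p) + 2 * ip p (X n - p) - 2 * \<phi> (X n - p)))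
      \<longlonglongrightarrow> J p + (0 + 2 * 0 - 2 * 0)"
    using lim by (intro tendsto_intros)
  moreover have "J p + (ip (X n - p) (X n - p) + 2 * ip p (X n - p) - 2 * \<phi> (X n - p)) = J (X n)" for n
    using XV[of n] p by (simp add: J_def ip_expand diff ip_commute[of p "X n"])
  ultimately have "(\<lambda>n. J (X n)) \<longlonglongrightarrow> J p"
    by simp
  moreover have "(\<lambda>n. m + 1 / real (Suc n)) \<longlonglongrightarrow> m"
    using tendsto_add[OF tendsto_const LIMSEQ_inverse_real_of_nat, of m] by (simp add: inverse_eq_divide)
  ultimately have "J p \<le> m"
    by (rule LIMSEQ_le) (use X(2) in \<open>auto intro!: exI[of _ 0] less_imp_le\<close>)
  then have min: "J p \<le> J s" if "s \<in> S" for s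
    using m[OF that] by simp
  have "0 \<le> ip p (s - p) - \<phi> (s - p)" if s: "s \<in> S" for s
  proof -
    have sV: "s \<in> V"
      using s SV by blast
    \<comment> \<open>Expansion of \<open>J\<close> along the segment from \<open>p\<close> to
      \<open>s\<close>; the coefficient of \<open>t\<close> carries the variational
      inequality.\<close>
    have "0 \<le> t * (2 * (ip p (s - p) - \<phi> (s - p))) + t\<^sup>2 * ip (s - p) (s - p)"
      if "0 < t" "t \<le> 1" for t
    proof -
      have eq: "(1 - t) *\<^sub>R p + t *\<^sub>R s = p + t *\<^sub>R (s - p)"
        by (simp add: algebra_simps)
      have "J p \<le> J (p + t *\<^sub>R (s - p))"
        using min comb[OF pS s, of t] that eq by simp
      also have "\<dots> = J p + (t * (2 * (ip p (s - p) - \<phi> (s - p))) + t\<^sup>2 * ip (s - p) (s - p))"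
      proof -
        have "J (p + t *\<^sub>R q) = J p + (t * (2 * (ip p q - \<phi> q)) + t\<^sup>2 * ip q q)" if "q \<in> V" for q
          using that p
          by (simp add: J_def ip_expand add scale ip_commute[of q p] power2_eq_square algebra_simps)
        then show ?thesis
          using p sV by simp
      qed
      finally show ?thesis
        by simp
    qed
    then have "0 \<le> 2 * (ip p (s - p) - \<phi> (s - p))"
      by (rule nonneg_if_quadratic_nonneg)
    then show ?thesis
      by simp
  qed
  then show ?thesis
    using pS min by (force simp: J_def)
qed

text \<open>The choice in \<open>proj\<close> may select another minimiser than the \<open>p\<close>
  constructed here. Two minimisers differ by a null vector, so the variational inequality of
  \<open>p\<close> carries over.\<close>

lemma proj:
  assumes S: "closed_convex S" "S \<noteq> {}" and z: "z \<in> V"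
  shows proj_mem: "proj S z \<in> S"
    and proj_variational: "s \<in> S \<Longrightarrow> ip (proj S z - z) (s - proj S z) \<ge> 0"
proof -
  have SV: "x \<in> V" if "x \<in> S" for x
    using S that by (auto simp: closed_convex_def)
  obtain p where p: "p \<in> S" "\<And>s. s \<in> S \<Longrightarrow> ip z (s - p) \<le> ip p (s - p)"
      "\<And>s. s \<in> S \<Longrightarrow> ip p p - 2 * ip z p \<le> ip s s - 2 * ip z s"
    using quadratic_functional_min[OF S, of "ip z" "nrm z"] z Cauchy_Schwarz[of z]
    by (auto simp: ip_expand)
  have "nrm (z - p) \<le> nrm (z - s)" if "s \<in> S" for s
    using p(1) p(3)[OF that] z SV[OF that] SV[OF p(1)]
    by (simp add: nrm_def ip_diff_left ip_diff_right ip_commute[of p z] ip_commute[of s z])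
  then have "p \<in> S \<and> (\<forall>s\<in>S. nrm (z - p) \<le> nrm (z - s))"
    using p(1) by blast
  then have *: "proj S z \<in> S" "\<And>s. s \<in> S \<Longrightarrow> nrm (z - proj S z) \<le> nrm (z - s)"
    using someI[of "\<lambda>p. p \<in> S \<and> (\<forall>s\<in>S. nrm (z - p) \<le> nrm (z - s))" p] by (auto simp: proj_def)
  then show "proj S z \<in> S"
    by simp
  define q where "q = proj S z"
  have V: "p \<in> V" "q \<in> V"
    using p * SV by (auto simp: q_def)
  have "nrm (z - q) \<le> nrm (z - p)"
    using * p by (auto simp: q_def)
  then have "ip (z - q) (z - q) \<le> ip (z - p) (z - p)"
    by (simp add: nrm_def)
  \<comment> \<open>The squared distance from \<open>z\<close> to \<open>q\<close> exceeds that to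
    \<open>p\<close> by the squared norm of \<open>q - p\<close> plus
    \<open>2 * ip (p - z) (q - p)\<close>, which is nonnegative by the inequality at
    \<open>p\<close>.\<close>
  then have "ip (q - p) (q - p) \<le> 0"
    using p(2)[of q] * V z
    by (simp add: q_def[symmetric] ip_expand ip_commute[of p z] ip_commute[of q z] ip_commute[of q p])
  then have "ip (q - p) (q - p) = 0"
    using ip_nonneg[of "q - p"] V by simp
  then have n: "ip (q - p) y = 0" if "y \<in> V" for y
    using ip_null V that by simp
  show "ip (proj S z - z) (s - proj S z) \<ge> 0" if s: "s \<in> S"
  proof -
    have "s \<in> V"
      using s SV by auto
    moreover have "ip q y = ip p y" if "y \<in> V" for y
      using n[OF that] that V by (simp add: ip_expand)
    moreover have "ip y q = ip y p" if "y \<in> V" for y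
      using calculation(2)[OF that] that V by (simp add: ip_commute)
    ultimately show ?thesis
      using p(2)[OF s] V z unfolding q_def[symmetric] by (simp add: ip_expand)
  qed
qed

lemma closed_convex_V: "closed_convex V"
  using subspace_V by (simp add: closed_convex_def subspace_imp_convex)

text \<open>On the whole space both \<open>p + x\<close> and \<open>p - x\<close> are competitors,
  so the variational inequality of the minimiser is an equality.\<close>

lemma Riesz:
  assumes add: "\<And>x y. x \<in> V \<Longrightarrow> y \<in> V \<Longrightarrow> \<phi> (x + y) = \<phi> x + \<phi> y"
    and scale: "\<And>c x. x \<in> V \<Longrightarrow> \<phi> (c *\<^sub>R x) = c * \<phi> x"
    and bd: "\<And>x. x \<in> V \<Longrightarrow> \<bar>\<phi> x\<bar> \<le> B * nrm x"
  obtains p where "p \<in> V" "\<And>x. x \<in> V \<Longrightarrow> ip p x = \<phi> x"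
proof -
  obtain p where p: "p \<in> V" "\<And>s. s \<in> V \<Longrightarrow> \<phi> (s - p) \<le> ip p (s - p)"
    using quadratic_functional_min[OF closed_convex_V _ assms] V_zero by blast
  have "ip p x = \<phi> x" if x: "x \<in> V" for x
    using p(2)[of "p + x"] p(2)[of "p + (-1) *\<^sub>R x"] p(1) x scale[of x "-1"] ip_minus_right[of x p]
    by simp
  then show thesis
    using that p by blast
qed

section \<open>Closed convex sets, weak cluster points and Opial's lemma\<close>

lemma closed_convexI:
  assumes "S \<subseteq> V"
    and "\<And>x y t. x \<in> S \<Longrightarrow> y \<in> S \<Longrightarrow> 0 \<le> t \<Longrightarrow> t \<le> 1 \<Longrightarrow> (1 - t) *\<^sub>R x + t *\<^sub>R y \<in> S"
    and "\<And>X x. (\<And>n::nat. X n \<in> S) \<Longrightarrow> x \<in> V \<Longrightarrow> (\<lambda>n. ip (X n - x) (X n - x)) \<longlonglongrightarrow> 0 \<Longrightarrow> x \<in> S"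
  shows "closed_convex S"
proof -
  have "(\<lambda>n. ip (X n - x) (X n - x)) \<longlonglongrightarrow> 0"
    if "\<And>n::nat. X n \<in> S" "x \<in> V" "(\<lambda>n. nrm (X n - x)) \<longlonglongrightarrow> 0" for X x
  proof -
    have "X n - x \<in> V" for n
      by (rule V_diff[OF subsetD[OF assms(1) that(1)] that(2)])
    then show ?thesis
      using tendsto_power[OF that(3), of 2] by (simp add: nrm_power2)
  qed
  then show ?thesis
    using assms unfolding closed_convex_def convex_alt by blast
qed

text \<open>Sequences of functionals live in a compact product space, so that cluster filters take the
  place of subsequences and no separability is needed.\<close>

lemma weak_cluster_point:
  assumes H: "H \<noteq> bot" and u: "\<And>k. u k \<in> V" and B: "\<And>k. nrm (u k) \<le> B"
  obtains H' x where "H' \<noteq> bot" "H' \<le> H" "x \<in> V" "wconv u x H'"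
proof -
  \<comment> \<open>Extending the functionals by 0 outside \<open>V\<close> makes them points of a
    product over the whole type. By Cauchy-Schwarz they stay in the box \<open>U\<close>, which is
    compact by Tychonoff.\<close>
  define f where "f k z = (if z \<in> V then ip (u k) z else 0)" for k z
  define U where "U = (\<Pi>\<^sub>E z\<in>UNIV. (if z \<in> V then {- (B * nrm z)..B * nrm z} else {0::real}))"
  have "compact U"
  proof -
    have "compactin (product_topology (\<lambda>z::'v. euclidean :: real topology) UNIV) U"
      unfolding U_def by (subst compactin_PiE) auto
    then show ?thesis
      by (simp add: euclidean_product_topology)
  qed
  have f: "f k \<in> U" for k
  proof -
    have "\<bar>ip (u k) z\<bar> \<le> B * nrm z" if z: "z \<in> V" for z
      using Cauchy_Schwarz[OF u z] mult_right_mono[OF B nrm_nonneg[OF z]] by (rule order_trans)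
    then show ?thesis
      by (auto simp: U_def f_def abs_le_iff) (metis add.inverse_inverse neg_le_iff_le)+
  qed
  obtain \<phi> where \<phi>: "\<phi> \<in> U" "inf (nhds \<phi>) (filtermap f H) \<noteq> bot"
    using \<open>compact U\<close> H f unfolding compact_filter
    by (metis (mono_tags, lifting) always_eventually eventually_filtermap filtermap_bot_iff)
  \<comment> \<open>Pulling the neighbourhoods of the cluster point \<open>\<phi>\<close> back to
    the indices refines \<open>H\<close> to a filter along which the functionals converge pointwise
    to \<open>\<phi>\<close>.\<close>
  define H' where "H' = inf (filtercomap f (nhds \<phi>)) H"
  have "H' \<noteq> bot"
  proof
    assume "H' = bot"
    then have "eventually (\<lambda>_. False) H'"
      by simp
    then obtain P Q where PQ: "eventually P (filtercomap f (nhds \<phi>))" "eventually Q H"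
        "\<And>k. P k \<Longrightarrow> Q k \<Longrightarrow> False"
      unfolding H'_def eventually_inf by blast
    then obtain R where R: "eventually R (nhds \<phi>)" "\<And>k. R (f k) \<Longrightarrow> P k"
      unfolding eventually_filtercomap by blast
    have "eventually (\<lambda>y. \<not> R y) (filtermap f H)"
      unfolding eventually_filtermap using PQ(2) by eventually_elim (use PQ(3) R(2) in blast)
    then have "eventually (\<lambda>_. False) (inf (nhds \<phi>) (filtermap f H))"
      unfolding eventually_inf using R(1) by blast
    then show False
      using \<phi>(2) by (simp add: eventually_False)
  qed
  moreover have "H' \<le> H"
    by (simp add: H'_def)
  have "filterlim f (nhds \<phi>) H'"
    by (simp add: H'_def filterlim_iff_le_filtercomap)
  then have flim: "((\<lambda>k. f k z) \<longlongrightarrow> \<phi> z) H'" for z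
    using continuous_on_tendsto_compose[OF continuous_on_product_coordinates[of z], of f \<phi> H'] by simp
  have lim: "((\<lambda>k. ip (u k) z) \<longlongrightarrow> \<phi> z) H'" if "z \<in> V" for z
    using flim[of z] that by (simp add: f_def)
  \<comment> \<open>A pointwise limit of linear functionals with the common bound \<open>B\<close>
    is linear with the same bound, by uniqueness of limits along \<open>H'\<close>; hence it is
    represented by a vector.\<close>
  obtain x where x: "x \<in> V" "\<And>z. z \<in> V \<Longrightarrow> ip x z = \<phi> z"
  proof (rule Riesz[of \<phi> B])
    fix y z
    assume V: "y \<in> V" "z \<in> V"
    have "((\<lambda>k. ip (u k) y + ip (u k) z) \<longlongrightarrow> \<phi> (y + z)) H'"
      using lim[of "y + z"] u V by (simp add: ip_expand)
    then show "\<phi> (y + z) = \<phi> y + \<phi> z"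
      using tendsto_unique[OF \<open>H' \<noteq> bot\<close> _ tendsto_add[OF lim[OF V(1)] lim[OF V(2)]]] by simp
  next
    fix c z
    assume V: "z \<in> V"
    have "((\<lambda>k. c * ip (u k) z) \<longlongrightarrow> \<phi> (c *\<^sub>R z)) H'"
      using lim[of "c *\<^sub>R z"] u V by (simp add: ip_expand)
    then show "\<phi> (c *\<^sub>R z) = c * \<phi> z"
      using tendsto_unique[OF \<open>H' \<noteq> bot\<close> _ tendsto_mult_left[OF lim[OF V], of c]] by simp
  next
    fix z
    assume "z \<in> V"
    then have "\<phi> z \<in> {- (B * nrm z)..B * nrm z}"
      using PiE_mem[OF \<phi>(1)[unfolded U_def], of z] by simp
    then show "\<bar>\<phi> z\<bar> \<le> B * nrm z"
      by (simp add: abs_le_iff)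
  qed blast
  then have "wconv u x H'"
    using lim by (simp add: wconv_def)
  then show thesis
    using that \<open>H' \<noteq> bot\<close> \<open>H' \<le> H\<close> x(1) by blast
qed

text \<open>Projecting \<open>x\<close> onto \<open>S\<close> gives a half-space that contains
  \<open>S\<close>. Its defining inequality is weakly continuous, so it also holds at
  \<open>x\<close>, which forces the distance from \<open>x\<close> to its projection to be
  zero.\<close>

lemma closed_convex_imp_weakly_closed:
  assumes S: "closed_convex S" and u: "\<And>k. u k \<in> S" and x: "x \<in> V"
    and w: "wconv u x H" and H: "H \<noteq> bot"
  shows "x \<in> S"
proof -
  have SV: "s \<in> V" if "s \<in> S" for s
    using S that by (auto simp: closed_convex_def)
  define p where "p = proj S x"
  have ne: "S \<noteq> {}"
    using u by auto
  have p: "p \<in> S" "\<And>s. s \<in> S \<Longrightarrow> ip (p - x) (s - p) \<ge> 0"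
    using proj[OF S ne x] by (auto simp: p_def)
  have "((\<lambda>k. ip (u k) (p - x) - ip p (p - x)) \<longlongrightarrow> ip x (p - x) - ip p (p - x)) H"
    using w p(1) x SV by (intro tendsto_diff tendsto_const) (auto simp: wconv_def)
  moreover have "0 \<le> ip (u k) (p - x) - ip p (p - x)" for k
    using p(2)[OF u[of k]] ip_commute[of "p - x" "u k - p"] SV[OF u[of k]] SV[OF p(1)] x
    by (simp add: ip_diff_left)
  ultimately have "0 \<le> ip x (p - x) - ip p (p - x)"
    by (intro tendsto_lowerbound[OF _ always_eventually H]) auto
  then have "ip (p - x) (p - x) \<le> 0"
    using SV[OF p(1)] x by (simp add: ip_expand)
  then have "nrm (p - x) = 0"
    using ip_nonneg[of "p - x"] SV[OF p(1)] x by (simp add: nrm_def)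
  then show ?thesis
    \<comment> \<open>The constant sequence at \<open>p\<close> converges to \<open>x\<close> in the
      seminorm, so closedness absorbs the null difference.\<close>
    by (intro closed_convexD[OF S p(1) x]) simp
qed

text \<open>The difference of the squared distances to two points is affine in \<open>u k\<close>.
  If both points are cluster points, it converges along the whole sequence, and its limit can be
  evaluated along either cluster filter; comparing the values shows that the points differ by a null
  vector.\<close>

lemma Opial:
  assumes S: "S \<subseteq> V" and u: "\<And>k. u k \<in> V" and B: "\<And>k. nrm (u k) \<le> B"
    and conv: "\<And>s. s \<in> S \<Longrightarrow> convergent (\<lambda>k. ip (u k - s) (u k - s))"
    and cluster: "\<And>H x. H \<noteq> bot \<Longrightarrow> H \<le> sequentially \<Longrightarrow> x \<in> V \<Longrightarrow> wconv u x H \<Longrightarrow> x \<in> S"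
  shows "\<exists>x\<in>S. wconv u x sequentially"
proof -
  obtain H x where H: "H \<noteq> bot" "H \<le> sequentially" "x \<in> V" "wconv u x H"
    using weak_cluster_point[OF sequentially_bot, of u B] u B by metis
  then have xS: "x \<in> S"
    using cluster by blast
  have unique: "ip (x - y) z = 0"
    if H': "H' \<noteq> bot" "H' \<le> sequentially" and y: "y \<in> V" "wconv u y H'" and z: "z \<in> V" for H' y z
  proof -
    have yS: "y \<in> S"
      using cluster[OF H' y] .
    obtain a b where "(\<lambda>k. ip (u k - x) (u k - x)) \<longlonglongrightarrow> a" "(\<lambda>k. ip (u k - y) (u k - y)) \<longlonglongrightarrow> b"
      using conv[OF xS] conv[OF yS] by (auto simp: convergent_def)
    \<comment> \<open>Polarisation: the quadratic terms in \<open>u k\<close> cancel, leaving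
      \<open>ip (u k) (x - y)\<close>.\<close>
    then have "(\<lambda>k. (ip (u k - y) (u k - y) - ip (u k - x) (u k - x) + ip x x - ip y y) / 2)
        \<longlonglongrightarrow> (b - a + ip x x - ip y y) / 2"
      by (intro tendsto_intros) simp_all
    moreover have "(ip (u k - y) (u k - y) - ip (u k - x) (u k - x) + ip x x - ip y y) / 2
        = ip (u k) (x - y)" for k
      using u[of k] H(3) y(1) by (simp add: ip_expand ip_commute[of x "u k"] ip_commute[of y "u k"])
    ultimately have lim: "(\<lambda>k. ip (u k) (x - y)) \<longlonglongrightarrow> (b - a + ip x x - ip y y) / 2" (is "_ \<longlonglongrightarrow> ?c")
      by simp
    have d: "x - y \<in> V"
      using H(3) y(1) by simp
    have "ip x (x - y) = ?c"
      using H(4) d by (intro tendsto_unique[OF H(1) _ tendsto_mono[OF H(2) lim]]) (simp add: wconv_def)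
    moreover have "ip y (x - y) = ?c"
      using y(2) d by (intro tendsto_unique[OF H'(1) _ tendsto_mono[OF H'(2) lim]]) (simp add: wconv_def)
    ultimately have "ip (x - y) (x - y) = 0"
      using H(3) y(1) by (simp add: ip_diff_left)
    then show ?thesis
      using ip_null H(3) y(1) z by simp
  qed
  have "wconv u x sequentially"
    unfolding wconv_def
  proof (rule ballI, rule tendstoI, rule ccontr)
    fix z and e :: real
    assume z: "z \<in> V" and e: "0 < e" and not: "\<not> (\<forall>\<^sub>F k in sequentially. dist (ip (u k) z) (ip x z) < e)"
    \<comment> \<open>If convergence fails at \<open>z\<close>, the bad indices recur and
      \<open>Q\<close> is proper. A cluster point taken along \<open>Q\<close> must agree with
      \<open>x\<close> on \<open>z\<close>, which the bad indices exclude.\<close>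
    define Q where "Q = inf sequentially (principal {k. \<not> dist (ip (u k) z) (ip x z) < e})"
    have "Q \<noteq> bot"
    proof
      assume "Q = bot"
      then have "eventually (\<lambda>_. False) Q"
        by simp
      then show False
        using not by (simp add: Q_def eventually_inf_principal)
    qed
    then obtain H' y where H': "H' \<noteq> bot" "H' \<le> Q" "y \<in> V" "wconv u y H'"
      using weak_cluster_point[of Q u B] u B by metis
    have "H' \<le> sequentially"
      using H'(2) by (simp add: Q_def)
    then have "ip (x - y) z = 0"
      using unique[OF H'(1) _ H'(3,4) z] by blast
    then have "((\<lambda>k. ip (u k) z) \<longlongrightarrow> ip x z) H'"
      using H'(3,4) H(3) z by (simp add: wconv_def ip_expand)
    then have "eventually (\<lambda>k. dist (ip (u k) z) (ip x z) < e) H'"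
      using e by (rule tendstoD)
    moreover have "eventually (\<lambda>k. \<not> dist (ip (u k) z) (ip x z) < e) H'"
      using H'(2) by (rule filter_leD) (simp add: Q_def eventually_inf_principal)
    ultimately have "eventually (\<lambda>_. False) H'"
      by eventually_elim blast
    then show False
      using H'(1) by (simp add: eventually_False)
  qed
  then show ?thesis
    using xS by blast
qed

section \<open>Null and bounded sequences\<close>

lemma nrm_tendsto_zero_le:
  assumes "\<And>k. u k \<in> V" "\<And>k. nrm (u k) \<le> b k" "(b \<longlongrightarrow> 0) H"
  shows "((\<lambda>k. nrm (u k)) \<longlongrightarrow> 0) H"
  by (rule tendsto_sandwich[OF _ _ tendsto_const assms(3)]) (use assms(1,2) in auto)

lemma nrm_tendsto_zeroI:
  assumes u: "\<And>k. u k \<in> V" and c: "0 < c"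
    and le: "\<And>k. c * ip (u k) (u k) \<le> b k" and b: "(b \<longlongrightarrow> 0) H"
  shows "((\<lambda>k. nrm (u k)) \<longlongrightarrow> 0) H"
proof -
  have "((\<lambda>k. ip (u k) (u k)) \<longlongrightarrow> 0) H"
  proof (rule tendsto_sandwich[OF _ _ tendsto_const])
    show "((\<lambda>k. b k / c) \<longlongrightarrow> 0) H"
      using tendsto_divide[OF b tendsto_const[of c]] c by simp
    show "\<forall>\<^sub>F k in H. ip (u k) (u k) \<le> b k / c"
      using le c by (simp add: pos_le_divide_eq mult.commute)
  qed (simp add: u ip_nonneg)
  then show ?thesis
    using tendsto_real_sqrt by (fastforce simp: nrm_def)
qed

definition nrm_bounded :: "(nat \<Rightarrow> 'v) \<Rightarrow> bool" where
  "nrm_bounded u \<longleftrightarrow> (\<exists>B. \<forall>k. u k \<in> V \<and> nrm (u k) \<le> B)"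

lemma nrm_bounded_const: "a \<in> V \<Longrightarrow> nrm_bounded (\<lambda>k. a)"
  by (auto simp: nrm_bounded_def)

lemma nrm_bounded_diff:
  assumes "nrm_bounded u" "nrm_bounded v"
  shows "nrm_bounded (\<lambda>k. u k - v k)"
proof -
  obtain A B where "\<And>k. u k \<in> V \<and> nrm (u k) \<le> A" "\<And>k. v k \<in> V \<and> nrm (v k) \<le> B"
    using assms by (auto simp: nrm_bounded_def)
  then have "u k - v k \<in> V \<and> nrm (u k - v k) \<le> A + B" for k
    using nrm_triangle_diff[of "u k" "v k"] by (smt (verit) V_diff)
  then show ?thesis
    by (auto simp: nrm_bounded_def)
qed

lemma nrm_bounded_null:
  assumes "\<And>k. u k \<in> V" "(\<lambda>k. nrm (u k)) \<longlonglongrightarrow> 0"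
  shows "nrm_bounded u"
proof -
  obtain B where "\<And>k. norm (nrm (u k)) \<le> B"
    using convergent_imp_Bseq[of "\<lambda>k. nrm (u k)"] assms(2) by (auto simp: convergent_def Bseq_def)
  then show ?thesis
    using assms(1) by (auto simp: nrm_bounded_def)
qed

lemma nrm_boundedI:
  assumes u: "\<And>k. u k \<in> V" and c: "0 < c" and le: "\<And>k. c * ip (u k) (u k) \<le> b"
  shows "nrm_bounded u"
  unfolding nrm_bounded_def nrm_def
proof (intro exI allI conjI u)
  show "sqrt (ip (u k) (u k)) \<le> sqrt (b / c)" for k
    using le[of k] c by (simp add: pos_le_divide_eq mult.commute)
qed

lemma nrm_bounded_tendsto_ip:
  assumes "nrm_bounded u" "\<And>k. v k \<in> V" "((\<lambda>k. nrm (v k)) \<longlongrightarrow> 0) H"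
  shows "((\<lambda>k. ip (v k) (u k)) \<longlongrightarrow> 0) H"
proof -
  obtain B where B: "\<And>k. u k \<in> V" "\<And>k. nrm (u k) \<le> B"
    using assms(1) by (auto simp: nrm_bounded_def)
  have "((\<lambda>k. ip (u k) (v k)) \<longlongrightarrow> 0) H"
    by (rule tendsto_ip_null[OF B(1) assms(2) B(2) assms(3)])
  then show ?thesis
    using B(1) assms(2) by (simp add: ip_commute)
qed

lemma wconv_tendsto_diff:
  assumes w: "wconv v x H" and V: "\<And>k. v k \<in> V" "x \<in> V" "c \<in> V" "u \<in> V"
  shows "((\<lambda>k. ip c (u - v k)) \<longlongrightarrow> ip c (u - x)) H"
proof -
  have "((\<lambda>k. ip c u - ip (v k) c) \<longlongrightarrow> ip c u - ip x c) H"
    using w V(3) by (intro tendsto_diff tendsto_const) (simp add: wconv_def)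
  then show ?thesis
    using V by (simp add: ip_diff_right ip_commute[of c "v _"] ip_commute[of c x])
qed

end

section \<open>The prediction-correction iteration\<close>

text \<open>With the weights \<open>\<beta> * r\<close>, \<open>\<beta>\<close> and
  \<open>1 / \<beta>\<close> this is the inner product of \<open>G p\<close> with
  \<open>q\<close>.\<close>

definition weighted_inner3 :: "real \<Rightarrow> real \<Rightarrow> real \<Rightarrow> ('v \<Rightarrow> 'v \<Rightarrow> real) \<Rightarrow> 'v \<times> 'v \<times> 'v \<Rightarrow> 'v \<times> 'v \<times> 'v \<Rightarrow> real" where
  "weighted_inner3 a b c ip = (\<lambda>(x, y, l) (x', y', l'). a * ip x x' + b * ip y y' + c * ip l l')"

lemma weighted_inner3_simp [simp]:
  "weighted_inner3 a b c ip (x, y, l) (x', y', l') = a * ip x x' + b * ip y y' + c * ip l l'"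
  by (simp add: weighted_inner3_def)

text \<open>Makes Opial's lemma available for triples in the \<open>G\<close>-norm. Completeness is
  inherited because each weighted component is bounded by the full form.\<close>

lemma (in semi_hilbert) semi_hilbert_triple:
  assumes pos: "0 < a" "0 < b" "0 < c"
  shows "semi_hilbert (V \<times> V \<times> V) (weighted_inner3 a b c ip)"
proof
  show "subspace (V \<times> V \<times> V)"
    by (intro subspace_Times subspace_V)
next
  fix X :: "nat \<Rightarrow> 'v \<times> 'v \<times> 'v"
  assume X: "\<And>n. X n \<in> V \<times> V \<times> V"
    and C: "\<And>e. 0 < e \<Longrightarrow> \<exists>k. \<forall>m\<ge>k. \<forall>n\<ge>k. weighted_inner3 a b c ip (X m - X n) (X m - X n) < e"
  define x y l where "x n = fst (X n)" and "y n = fst (snd (X n))" and "l n = snd (snd (X n))" for n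
  have XE: "X n = (x n, y n, l n)" for n
    by (simp add: x_def y_def l_def)
  have V: "x n \<in> V" "y n \<in> V" "l n \<in> V" for n
    using X[of n] by (auto simp: XE)
  have lim: "\<exists>z\<in>V. (\<lambda>n. ip (u n - z) (u n - z)) \<longlonglongrightarrow> 0"
    if "0 < q" and u: "\<And>n. u n \<in> V"
      and le: "\<And>m n. q * ip (u m - u n) (u m - u n) \<le> weighted_inner3 a b c ip (X m - X n) (X m - X n)"
    for q and u :: "nat \<Rightarrow> 'v"
  proof (rule ip_complete[OF u])
    fix e :: real
    assume "0 < e"
    then obtain k where k: "\<forall>m\<ge>k. \<forall>n\<ge>k. weighted_inner3 a b c ip (X m - X n) (X m - X n) < q * e"
      using C[of "q * e"] \<open>0 < q\<close> by auto
    have "ip (u m - u n) (u m - u n) < e" if "m \<ge> k" "n \<ge> k" for m n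
    proof -
      have "q * ip (u m - u n) (u m - u n) < q * e"
        using le[of m n] k that by (meson le_less_trans)
      then show ?thesis
        using \<open>0 < q\<close> by simp
    qed
    then show "\<exists>k. \<forall>m\<ge>k. \<forall>n\<ge>k. ip (u m - u n) (u m - u n) < e"
      by blast
  qed
  have nonneg: "0 \<le> a * ip (x m - x n) (x m - x n)" "0 \<le> b * ip (y m - y n) (y m - y n)"
      "0 \<le> c * ip (l m - l n) (l m - l n)" for m n
    using pos V ip_nonneg by simp_all
  have "\<exists>z\<in>V. (\<lambda>n. ip (x n - z) (x n - z)) \<longlonglongrightarrow> 0"
    by (rule lim[OF pos(1) V(1)]) (use nonneg in \<open>simp add: XE\<close>)
  moreover have "\<exists>z\<in>V. (\<lambda>n. ip (y n - z) (y n - z)) \<longlonglongrightarrow> 0"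
    by (rule lim[OF pos(2) V(2)]) (use nonneg in \<open>simp add: XE\<close>)
  moreover have "\<exists>z\<in>V. (\<lambda>n. ip (l n - z) (l n - z)) \<longlonglongrightarrow> 0"
    by (rule lim[OF pos(3) V(3)]) (use nonneg in \<open>simp add: XE\<close>)
  ultimately obtain u v w where uvw: "u \<in> V" "v \<in> V" "w \<in> V"
      "(\<lambda>n. ip (x n - u) (x n - u)) \<longlonglongrightarrow> 0" "(\<lambda>n. ip (y n - v) (y n - v)) \<longlonglongrightarrow> 0"
      "(\<lambda>n. ip (l n - w) (l n - w)) \<longlonglongrightarrow> 0"
    by blast
  have "(\<lambda>n. a * ip (x n - u) (x n - u) + b * ip (y n - v) (y n - v) + c * ip (l n - w) (l n - w))
      \<longlonglongrightarrow> a * 0 + b * 0 + c * 0"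
    by (intro tendsto_intros uvw)
  then show "\<exists>z\<in>V \<times> V \<times> V. (\<lambda>n. weighted_inner3 a b c ip (X n - z) (X n - z)) \<longlonglongrightarrow> 0"
    using uvw by (intro bexI[of _ "(u, v, w)"]) (auto simp: XE)
next
  fix p q s :: "'v \<times> 'v \<times> 'v" and t :: real
  assume V: "p \<in> V \<times> V \<times> V" "q \<in> V \<times> V \<times> V"
  show "weighted_inner3 a b c ip p q = weighted_inner3 a b c ip q p"
    using V by (auto simp: ip_commute)
  show "weighted_inner3 a b c ip (t *\<^sub>R p) q = t * weighted_inner3 a b c ip p q"
    using V by (auto simp: ip_scale_left algebra_simps)
  show "0 \<le> weighted_inner3 a b c ip p p"
    using V pos by (auto simp: ip_nonneg)
  assume "s \<in> V \<times> V \<times> V"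
  then show "weighted_inner3 a b c ip (p + q) s = weighted_inner3 a b c ip p s + weighted_inner3 a b c ip q s"
    using V by (auto simp: ip_add_left algebra_simps)
qed

section \<open>The variational inequality and its Minty form\<close>

locale splitting_vi = semi_hilbert V ip
  for V :: "'v::real_vector set" and ip +
  fixes C N :: "'v set" and F :: "'v \<Rightarrow> 'v" and L \<beta> r :: real
  assumes C: "closed_convex C" and N: "closed_convex N"
    and F_mem [simp]: "x \<in> V \<Longrightarrow> F x \<in> V"
    and F_mono: "x \<in> V \<Longrightarrow> y \<in> V \<Longrightarrow> 0 \<le> ip (F x - F y) (x - y)"
    and F_lip: "x \<in> V \<Longrightarrow> y \<in> V \<Longrightarrow> nrm (F x - F y) \<le> L * nrm (x - y)"
    and L_pos: "0 < L" and \<beta>_pos: "0 < \<beta>" and r_gt: "L / \<beta> + 1 < r"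
begin

definition solution :: "'v \<Rightarrow> 'v \<Rightarrow> 'v \<Rightarrow> bool" where
  "solution x y l \<longleftrightarrow> x \<in> C \<and> y \<in> N \<and> l \<in> V \<and>
     (\<forall>u\<in>C. \<forall>v\<in>N. \<forall>w\<in>V. 0 \<le> ip (F x - l) (u - x) + ip l (v - y) + ip (x - y) (w - l))"

lemma r_pos: "0 < r"
proof -
  have "0 < L / \<beta>"
    using L_pos \<beta>_pos by simp
  then show ?thesis
    using r_gt by linarith
qed

text \<open>The condition on \<open>r\<close> in the form in which it is used: the ratio bounds the
  size of \<zeta> / (\<beta> r) relative to the error of the \<open>x\<close> prediction.\<close>

lemma step_ratio: "(L + \<beta>) / (\<beta> * r) < 1"
proof -
  have "L + \<beta> < \<beta> * r"
    using mult_strict_left_mono[OF r_gt \<beta>_pos] \<beta>_pos by (simp add: algebra_simps)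
  then show ?thesis
    using \<beta>_pos r_pos by simp
qed

sublocale G: semi_hilbert "V \<times> V \<times> V" "weighted_inner3 (\<beta> * r) \<beta> (1 / \<beta>) ip"
  using \<beta>_pos r_pos by (intro semi_hilbert_triple) simp_all

lemma C_V: "x \<in> C \<Longrightarrow> x \<in> V" and N_V: "x \<in> N \<Longrightarrow> x \<in> V"
  using C N by (auto simp: closed_convex_def)

lemma solution_V: "solution x y l \<Longrightarrow> x \<in> V \<and> y \<in> V \<and> l \<in> V"
  by (simp add: solution_def C_V N_V)

text \<open>The part of \<open>T\<close> that is linear in the triple is skew: tested with the
  difference of the two points, its contributions cancel.\<close>

lemma operator_difference:
  assumes V: "u \<in> V" "v \<in> V" "w \<in> V" "u' \<in> V" "v' \<in> V" "w' \<in> V"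
  shows "ip (F u - w) (u - u') + ip w (v - v') + ip (u - v) (w - w')
    = ip (F u' - w') (u - u') + ip w' (v - v') + ip (u' - v') (w - w') + ip (F u - F u') (u - u')"
proof -
  have w: "ip (u - v) (w - w') = ip (w - w') (u - v)" "ip (u' - v') (w - w') = ip (w - w') (u' - v')"
    using V by (simp_all add: ip_commute)
  show ?thesis
    unfolding w using V by (simp add: ip_diff_left ip_diff_right)
qed

lemma operator_mono:
  assumes "u \<in> V" "v \<in> V" "w \<in> V" "u' \<in> V" "v' \<in> V" "w' \<in> V"
  shows "ip (F u' - w') (u - u') + ip w' (v - v') + ip (u' - v') (w - w')
    \<le> ip (F u - w) (u - u') + ip w (v - v') + ip (u - v) (w - w')"
  using operator_difference[OF assms] F_mono assms by simp

text \<open>Apply the hypothesis at a point of the segment from the candidate to a test point.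
  Moving the operator back to the candidate costs only the \<open>F\<close> term, which is of order
  \<open>t\<^sup>2\<close> by the Lipschitz bound; dividing by \<open>t\<close> and letting
  \<open>t\<close> tend to 0 gives the inequality at the candidate.\<close>

lemma Minty:
  assumes mem: "x \<in> C" "y \<in> N" "l \<in> V"
    and vi: "\<And>u v w. u \<in> C \<Longrightarrow> v \<in> N \<Longrightarrow> w \<in> V \<Longrightarrow>
      0 \<le> ip (F u - w) (u - x) + ip w (v - y) + ip (u - v) (w - l)"
  shows "solution x y l"
  unfolding solution_def
proof (intro conjI ballI mem)
  fix u v w
  assume uvw: "u \<in> C" "v \<in> N" "w \<in> V"
  have V: "x \<in> V" "y \<in> V" "u \<in> V" "v \<in> V"
    using mem uvw C_V N_V by auto
  let ?A = "ip (F x - l) (u - x) + ip l (v - y) + ip (x - y) (w - l)"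
  have "0 \<le> t * ?A + t\<^sup>2 * (L * ip (u - x) (u - x))" if t: "0 < t" "t \<le> 1" for t
  proof -
    define x' y' l' where "x' = x + t *\<^sub>R (u - x)" and "y' = y + t *\<^sub>R (v - y)" and "l' = l + t *\<^sub>R (w - l)"
    have V': "x' \<in> V" "y' \<in> V" "l' \<in> V"
      using V mem(3) uvw(3) by (simp_all add: x'_def y'_def l'_def)
    have d: "x' - x = t *\<^sub>R (u - x)" "y' - y = t *\<^sub>R (v - y)" "l' - l = t *\<^sub>R (w - l)"
      by (simp_all add: x'_def y'_def l'_def)
    have "x' = (1 - t) *\<^sub>R x + t *\<^sub>R u" "y' = (1 - t) *\<^sub>R y + t *\<^sub>R v"
      by (simp_all add: x'_def y'_def algebra_simps)
    then have "x' \<in> C" "y' \<in> N"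
      using C N mem uvw t by (auto simp: closed_convex_def convex_alt)
    then have "0 \<le> ip (F x' - l') (x' - x) + ip l' (y' - y) + ip (x' - y') (l' - l)"
      using V'(3) by (rule vi)
    also have "\<dots> = ip (F x - l) (x' - x) + ip l (y' - y) + ip (x - y) (l' - l) + ip (F x' - F x) (x' - x)"
      using V V' mem(3) by (intro operator_difference)
    also have "ip (F x' - F x) (x' - x) \<le> nrm (F x' - F x) * nrm (x' - x)"
      using Cauchy_Schwarz[of "F x' - F x" "x' - x"] V V' by simp
    also have "\<dots> \<le> (L * nrm (x' - x)) * nrm (x' - x)"
      using V V' F_lip by (intro mult_right_mono) auto
    also have "\<dots> = t\<^sup>2 * (L * ip (u - x) (u - x))"
      using V t by (simp add: d nrm_scale flip: nrm_power2) (simp add: power2_eq_square)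
    finally show ?thesis
      using V mem(3) uvw(3) by (simp add: d ip_scale_right distrib_left)
  qed
  then show "0 \<le> ?A"
    by (rule nonneg_if_quadratic_nonneg)
qed

end

section \<open>The prediction-correction iterates and their descent\<close>

locale admm = splitting_vi V ip C N F L \<beta> r
  for V :: "'v::real_vector set" and ip C N F L \<beta> r +
  fixes \<alpha> :: real and x y l xt yt lt :: "nat \<Rightarrow> 'v"
  assumes \<alpha>: "0 < \<alpha>" "\<alpha> < 1"
    and C_nonempty: "C \<noteq> {}" and N_nonempty: "N \<noteq> {}"
    and start: "x 0 \<in> V" "y 0 \<in> V" "l 0 \<in> V"
    and xt_eq: "xt k = proj C (x k - (1 / (\<beta> * r)) *\<^sub>R (F (x k) - l k + \<beta> *\<^sub>R (x k - y k)))"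
    and yt_eq: "yt k = proj N (y k - (1 / \<beta>) *\<^sub>R (l k - \<beta> *\<^sub>R (xt k - y k)))"
    and lt_eq: "lt k = l k - \<beta> *\<^sub>R (xt k - yt k)"
    and x_Suc: "x (Suc k) = x k - \<alpha> *\<^sub>R
      (x k - xt k - (1 / (\<beta> * r)) *\<^sub>R (F (x k) - F (xt k) + \<beta> *\<^sub>R (x k - xt k)))"
    and y_Suc: "y (Suc k) = y k - \<alpha> *\<^sub>R (y k - yt k)"
    and l_Suc: "l (Suc k) = l k - \<alpha> *\<^sub>R (l k - lt k)"
begin

definition "ex k = x k - xt k"
definition "ey k = y k - yt k"
definition "el k = l k - lt k"
definition "\<zeta> k = F (x k) - F (xt k) + \<beta> *\<^sub>R ex k"
text \<open>First component of the residual. The term in \<open>ey\<close> appears because the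
  projection step uses \<open>l k\<close> and \<open>y k\<close>, while the inequality is to hold
  with \<open>lt k\<close>, which is built from \<open>yt k\<close>.\<close>

definition "g k = (\<beta> * r) *\<^sub>R ex k - \<zeta> k + \<beta> *\<^sub>R ey k"
definition "d k = (ex k - (1 / (\<beta> * r)) *\<^sub>R \<zeta> k, ey k, el k)"
definition "\<theta> k = (x k, y k, l k)"

abbreviation ipG where "ipG \<equiv> weighted_inner3 (\<beta> * r) \<beta> (1 / \<beta>) ip"

lemma iterates_V [simp]: "x k \<in> V" "y k \<in> V" "l k \<in> V"
  and xt_C: "xt k \<in> C" and yt_N: "yt k \<in> N"
proof -
  have step: "xt k \<in> C \<and> yt k \<in> N" if "x k \<in> V" "y k \<in> V" "l k \<in> V" for k
  proof
    show "xt k \<in> C"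
      unfolding xt_eq using that by (intro proj_mem C C_nonempty) simp
    then have "xt k \<in> V"
      by (rule C_V)
    then show "yt k \<in> N"
      unfolding yt_eq using that by (intro proj_mem N N_nonempty) simp
  qed
  have V: "x k \<in> V \<and> y k \<in> V \<and> l k \<in> V" for k
  proof (induction k)
    case (Suc k)
    then have "xt k \<in> V" "yt k \<in> V"
      using step C_V N_V by blast+
    then show ?case
      using Suc by (simp add: x_Suc y_Suc l_Suc lt_eq)
  qed (simp add: start)
  then show "x k \<in> V" "y k \<in> V" "l k \<in> V" "xt k \<in> C" "yt k \<in> N"
    using step by blast+
qed

lemma predictions_V [simp]: "xt k \<in> V" "yt k \<in> V" "lt k \<in> V"
  using C_V[OF xt_C] N_V[OF yt_N] by (simp_all add: lt_eq)

lemma errors_V [simp]: "ex k \<in> V" "ey k \<in> V" "el k \<in> V" "\<zeta> k \<in> V" "g k \<in> V"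
  by (simp_all add: ex_def ey_def el_def \<zeta>_def g_def)

lemma el_eq: "el k = \<beta> *\<^sub>R (xt k - yt k)"
  by (simp add: el_def lt_eq)

text \<open>The projection inequalities are scaled by \<open>\<beta> * r\<close> and
  \<open>\<beta>\<close> to clear the step sizes; the multiplier update supplies the third component
  as an identity.\<close>

lemma prediction_vi:
  assumes u: "u \<in> C" and v: "v \<in> N" and w: "w \<in> V"
  shows "ip (g k) (u - xt k) + ip (el k) (w - lt k) / \<beta>
    \<le> ip (F (xt k) - lt k) (u - xt k) + ip (lt k) (v - yt k) + ip (xt k - yt k) (w - lt k)"
proof -
  have V: "u \<in> V" "v \<in> V"
    using u v C_V N_V by auto
  let ?z = "x k - (1 / (\<beta> * r)) *\<^sub>R (F (x k) - l k + \<beta> *\<^sub>R (x k - y k))"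
  have "F (xt k) - lt k - g k = (\<beta> * r) *\<^sub>R (xt k - ?z)"
    using \<beta>_pos r_pos
    by (simp add: g_def \<zeta>_def ex_def ey_def lt_eq scaleR_diff_right scaleR_add_right)
  moreover have "0 \<le> ip (xt k - ?z) (u - xt k)"
    unfolding xt_eq by (rule proj_variational[OF C C_nonempty _ u]) simp
  ultimately have 1: "0 \<le> ip (F (xt k) - lt k - g k) (u - xt k)"
    using \<beta>_pos r_pos V by (simp add: ip_scale_left)
  let ?z = "y k - (1 / \<beta>) *\<^sub>R (l k - \<beta> *\<^sub>R (xt k - y k))"
  \<comment> \<open>The scaled projection error is exactly the new multiplier, so the
    \<open>y\<close> component carries no residual.\<close>
  have "lt k = \<beta> *\<^sub>R (yt k - ?z)"
    using \<beta>_pos by (simp add: lt_eq scaleR_diff_right scaleR_add_right)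
  moreover have "0 \<le> ip (yt k - ?z) (v - yt k)"
    unfolding yt_eq by (rule proj_variational[OF N N_nonempty _ v]) simp
  moreover have "ip (\<beta> *\<^sub>R (yt k - ?z)) (v - yt k) = \<beta> * ip (yt k - ?z) (v - yt k)"
    by (rule ip_scale_left) (use V in simp_all)
  ultimately have 2: "0 \<le> ip (lt k) (v - yt k)"
    using \<beta>_pos by simp
  have 3: "ip (el k) (w - lt k) / \<beta> = ip (xt k - yt k) (w - lt k)"
    using \<beta>_pos w by (simp add: el_eq ip_scale_left)
  show ?thesis
    using 1 2 V unfolding 3 by (simp add: ip_diff_left)
qed

lemma \<zeta>_bound: "nrm (\<zeta> k) \<le> (L + \<beta>) * nrm (ex k)"
proof -
  have "nrm (\<zeta> k) \<le> nrm (F (x k) - F (xt k)) + nrm (\<beta> *\<^sub>R ex k)"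
    unfolding \<zeta>_def by (intro nrm_triangle) simp_all
  also have "\<dots> \<le> L * nrm (ex k) + \<beta> * nrm (ex k)"
    using F_lip[of "x k" "xt k"] \<beta>_pos by (simp add: nrm_scale ex_def)
  finally show ?thesis
    by (simp add: algebra_simps)
qed

text \<open>The multiplier is unconstrained: testing with \<open>ls - (xs - ys)\<close> makes the
  squared norm of \<open>xs - ys\<close> nonpositive. The conclusion is phrased through
  \<open>ip\<close> because the difference is only null.\<close>

lemma solution_gap_null:
  assumes "solution xs ys ls" "z \<in> V"
  shows "ip z (xs - ys) = 0"
proof -
  have V: "xs \<in> V" "ys \<in> V" "ls \<in> V"
    using solution_V assms by auto
  have "0 \<le> ip (F xs - ls) (xs - xs) + ip ls (ys - ys) + ip (xs - ys) (ls - (xs - ys) - ls)"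
    using assms(1) V unfolding solution_def by (metis V_diff)
  moreover have "ls - (xs - ys) - ls = - (xs - ys)"
    by simp
  ultimately have "ip (xs - ys) (xs - ys) \<le> 0"
    using V ip_minus_right[of "xs - ys" "xs - ys"] by simp
  then have "ip (xs - ys) (xs - ys) = 0"
    using ip_nonneg[of "xs - ys"] V by simp
  then show ?thesis
    using ip_null[of "xs - ys" z] V assms(2) by (simp add: ip_commute[of z])
qed

text \<open>
  The term \<open>\<beta> *\<^sub>R ey k\<close> sits in the first component of the residual \<open>g k\<close>, but in the second component of
  \<open>G d\<close>. The mismatch is \<open>ip (ey k) (el k)\<close>, because a solution satisfies \<open>xs = ys\<close> almost surely, and
  the \<open>y\<close> and \<open>l\<close> parts of \<open>ipG (d k) (d k)\<close> absorb it.
\<close>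

lemma descent_direction:
  assumes sol: "solution xs ys ls"
  shows "ipG (d k) (d k) \<le> 2 * ipG (d k) (\<theta> k - (xs, ys, ls))"
proof -
  have V: "xs \<in> V" "ys \<in> V" "ls \<in> V" and K: "xs \<in> C" "ys \<in> N"
    using solution_V[OF sol] sol by (auto simp: solution_def)
  have \<beta>r: "0 < \<beta> * r"
    using \<beta>_pos r_pos by simp
  define px py pl where "px = xt k - xs" and "py = yt k - ys" and "pl = lt k - ls"
  have pV: "px \<in> V" "py \<in> V" "pl \<in> V"
    using V by (simp_all add: px_def py_def pl_def)
  have "0 \<le> ip (F xs - ls) px + ip ls py + ip (xs - ys) pl"
    using sol xt_C yt_N unfolding solution_def px_def py_def pl_def by simp
  also have "\<dots> \<le> ip (F (xt k) - lt k) px + ip (lt k) py + ip (xt k - yt k) pl"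
    unfolding px_def py_def pl_def using V by (intro operator_mono) simp_all
  also have "\<dots> \<le> ip (g k) px + ip (el k) pl / \<beta>"
    using prediction_vi[OF K V(3), of k] V \<beta>_pos
    by (simp add: px_def py_def pl_def ip_diff_right diff_divide_distrib)
  also have "ip (g k) px = ip ((\<beta> * r) *\<^sub>R ex k - \<zeta> k) px + \<beta> * ip (ey k) px"
    using pV by (simp add: g_def ip_add_left ip_scale_left)
  also have "\<beta> * ip (ey k) px = \<beta> * ip (ey k) py + ip (ey k) (el k)"
    using V solution_gap_null[OF sol, of "ey k"]
    by (simp add: px_def py_def el_eq ip_diff_right ip_scale_right algebra_simps)
  finally have p: "- ip (ey k) (el k) \<le> ipG (d k) (px, py, pl)"
    using pV \<beta>_pos r_pos by (simp add: d_def ip_expand algebra_simps)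
  \<comment> \<open>Completing the square with weight \<open>\<beta>\<close> pays for the misplaced
    term \<open>ip (ey k) (el k)\<close>.\<close>
  have "0 \<le> \<beta> * ip (ey k - (1 / \<beta>) *\<^sub>R el k) (ey k - (1 / \<beta>) *\<^sub>R el k)"
    using \<beta>_pos by (simp add: ip_nonneg)
  also have "\<dots> = \<beta> * ip (ey k) (ey k) + ip (el k) (el k) / \<beta> - 2 * ip (ey k) (el k)"
    using \<beta>_pos by (simp add: ip_expand ip_commute[of "el k" "ey k"] field_simps)
  finally have sq: "2 * ip (ey k) (el k) \<le> \<beta> * ip (ey k) (ey k) + ip (el k) (el k) / \<beta>"
    by simp
  \<comment> \<open>Here the bound on \<open>r\<close> enters the descent: \<zeta> is no larger than
    \<beta> r times the error.\<close>
  have "nrm (\<zeta> k) \<le> (\<beta> * r) * nrm (ex k)"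
    using \<zeta>_bound[of k] step_ratio \<beta>r mult_right_mono[of "L + \<beta>" "\<beta> * r" "nrm (ex k)"] by simp
  then have "(nrm (\<zeta> k))\<^sup>2 \<le> ((\<beta> * r) * nrm (ex k))\<^sup>2"
    by (intro power_mono) simp_all
  then have "ip (\<zeta> k) (\<zeta> k) \<le> (\<beta> * r) * ((\<beta> * r) * ip (ex k) (ex k))"
    by (simp add: power_mult_distrib nrm_power2) (simp add: power2_eq_square algebra_simps)
  then have \<zeta>: "ip (\<zeta> k) (\<zeta> k) / (\<beta> * r) \<le> (\<beta> * r) * ip (ex k) (ex k)"
    using \<beta>r by (simp add: pos_divide_le_eq mult.commute)
  \<comment> \<open>For vectors a and e, 2<a,e> - <a,a> equals <e,e> - <e-a,e-a>. In the first
    component e - a is \<zeta> / (\<beta> r); in the other two it is zero.\<close>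
  have "2 * ipG (d k) (ex k, ey k, el k) - ipG (d k) (d k)
      = (\<beta> * r) * ip (ex k) (ex k) - ip (\<zeta> k) (\<zeta> k) / (\<beta> * r)
        + \<beta> * ip (ey k) (ey k) + ip (el k) (el k) / \<beta>"
    using \<beta>r \<beta>_pos r_pos by (simp add: d_def ip_expand ip_commute[of "\<zeta> k" "ex k"] field_simps)
  moreover have eq: "\<theta> k - (xs, ys, ls) = (ex k, ey k, el k) + (px, py, pl)"
    by (simp add: \<theta>_def ex_def ey_def el_def px_def py_def pl_def)
  moreover have "ipG (d k) ((ex k, ey k, el k) + (px, py, pl))
      = ipG (d k) (ex k, ey k, el k) + ipG (d k) (px, py, pl)"
    by (rule G.ip_add_right) (use pV in \<open>simp_all add: d_def\<close>)
  ultimately show ?thesis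
    using p sq \<zeta> unfolding eq by linarith
qed

lemma \<theta>_V [simp]: "\<theta> k \<in> V \<times> V \<times> V" and d_V [simp]: "d k \<in> V \<times> V \<times> V"
  by (simp_all add: \<theta>_def d_def)

lemma \<theta>_Suc: "\<theta> (Suc k) = \<theta> k - \<alpha> *\<^sub>R d k"
  by (simp add: \<theta>_def d_def x_Suc y_Suc l_Suc ex_def ey_def el_def \<zeta>_def)

text \<open>Expanding the square gives a cross term of at most -\<alpha> <Gd,d> by
  \<open>descent_direction\<close> and a quadratic term \<alpha>^2 <Gd,d>; together they leave the
  factor \<alpha> (1 - \<alpha>).\<close>

lemma Fejer:
  assumes sol: "solution xs ys ls"
  shows "ipG (\<theta> (Suc k) - (xs, ys, ls)) (\<theta> (Suc k) - (xs, ys, ls))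
    \<le> ipG (\<theta> k - (xs, ys, ls)) (\<theta> k - (xs, ys, ls)) - \<alpha> * (1 - \<alpha>) * ipG (d k) (d k)"
proof -
  define s where "s = \<theta> k - (xs, ys, ls)"
  have sV: "s \<in> V \<times> V \<times> V"
    unfolding s_def using solution_V[OF sol] by (intro G.V_diff) simp_all
  have le: "\<alpha> * ipG (d k) (d k) \<le> \<alpha> * (2 * ipG (d k) s)"
    unfolding s_def using \<alpha> by (intro mult_left_mono descent_direction sol) simp
  have eq: "\<theta> (Suc k) - (xs, ys, ls) = s - \<alpha> *\<^sub>R d k"
    by (simp add: s_def \<theta>_Suc)
  have "ipG (s - \<alpha> *\<^sub>R d k) (s - \<alpha> *\<^sub>R d k)
      = ipG s s - \<alpha> * (2 * ipG (d k) s) + \<alpha>\<^sup>2 * ipG (d k) (d k)"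
    using sV d_V by (rule G.ip_diff_scale_self)
  moreover have "\<alpha> * (1 - \<alpha>) * ipG (d k) (d k) = \<alpha> * ipG (d k) (d k) - \<alpha>\<^sup>2 * ipG (d k) (d k)"
    by (simp add: power2_eq_square left_diff_distrib right_diff_distrib)
  ultimately show ?thesis
    using le unfolding eq s_def[symmetric] by simp
qed

text \<open>The squared distances decrease and are nonnegative, hence converge; their consecutive
  differences dominate the direction terms.\<close>

lemma Fejer_limits:
  assumes sol: "solution xs ys ls"
  shows convergent_distance: "convergent (\<lambda>k. ipG (\<theta> k - (xs, ys, ls)) (\<theta> k - (xs, ys, ls)))"
    and distance_bounded: "ipG (\<theta> k - (xs, ys, ls)) (\<theta> k - (xs, ys, ls))
      \<le> ipG (\<theta> 0 - (xs, ys, ls)) (\<theta> 0 - (xs, ys, ls))"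
    and direction_tendsto: "(\<lambda>k. ipG (d k) (d k)) \<longlonglongrightarrow> 0"
proof -
  define a where "a k = ipG (\<theta> k - (xs, ys, ls)) (\<theta> k - (xs, ys, ls))" for k
  have c: "0 < \<alpha> * (1 - \<alpha>)"
    using \<alpha> by simp
  have a0: "0 \<le> a k" for k
    unfolding a_def using solution_V[OF sol] by (intro G.ip_nonneg G.V_diff) simp_all
  have d0: "0 \<le> ipG (d k) (d k)" for k
    by (intro G.ip_nonneg d_V)
  have step: "\<alpha> * (1 - \<alpha>) * ipG (d k) (d k) \<le> a k - a (Suc k)" for k
    using Fejer[OF sol, of k] unfolding a_def by linarith
  have "a (Suc k) \<le> a k" for k
    using order_trans[OF mult_nonneg_nonneg[OF less_imp_le[OF c] d0] step, of k] by simp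
  then have dec: "decseq a"
    by (rule decseq_SucI)
  then obtain b where b: "a \<longlonglongrightarrow> b"
    using decseq_convergent[of a 0] a0 by blast
  then show "convergent (\<lambda>k. ipG (\<theta> k - (xs, ys, ls)) (\<theta> k - (xs, ys, ls)))"
    unfolding a_def[symmetric] by (auto simp: convergent_def)
  show "ipG (\<theta> k - (xs, ys, ls)) (\<theta> k - (xs, ys, ls))
      \<le> ipG (\<theta> 0 - (xs, ys, ls)) (\<theta> 0 - (xs, ys, ls))"
    using decseqD[OF dec, of 0 k] by (simp add: a_def)
  show "(\<lambda>k. ipG (d k) (d k)) \<longlonglongrightarrow> 0"
  proof (rule tendsto_sandwich[OF _ _ tendsto_const])
    show "(\<lambda>k. (a k - a (Suc k)) / (\<alpha> * (1 - \<alpha>))) \<longlonglongrightarrow> 0"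
      using tendsto_diff[OF b LIMSEQ_Suc[OF b]] by (intro tendsto_divide_zero) simp
    show "\<forall>\<^sub>F k in sequentially. ipG (d k) (d k) \<le> (a k - a (Suc k)) / (\<alpha> * (1 - \<alpha>))"
      using step c by (intro always_eventually allI) (simp add: pos_le_divide_eq mult.commute)
  qed (simp add: d0)
qed

section \<open>Vanishing errors and bounded predictions\<close>

lemma ipG_components:
  assumes "a \<in> V" "b \<in> V" "c \<in> V"
  shows "(\<beta> * r) * ip a a \<le> ipG (a, b, c) (a, b, c)" "\<beta> * ip b b \<le> ipG (a, b, c) (a, b, c)"
    "(1 / \<beta>) * ip c c \<le> ipG (a, b, c) (a, b, c)"
  using assms \<beta>_pos r_pos by (simp_all add: ip_nonneg)

text \<open>The \<open>y\<close> and \<open>l\<close> errors are components of \<open>d\<close>. The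
  \<open>x\<close> error is recovered from the first component of \<open>d\<close> by absorbing
  \<zeta> / (\<beta> r), at most \<open>q\<close> times that error with \<open>q < 1\<close>; the
  residual is then bounded by the errors.\<close>

lemma errors_tendsto:
  assumes sol: "solution xs ys ls"
  shows ex_tendsto: "(\<lambda>k. nrm (ex k)) \<longlonglongrightarrow> 0" and ey_tendsto: "(\<lambda>k. nrm (ey k)) \<longlonglongrightarrow> 0"
    and el_tendsto: "(\<lambda>k. nrm (el k)) \<longlonglongrightarrow> 0" and g_tendsto: "(\<lambda>k. nrm (g k)) \<longlonglongrightarrow> 0"
proof -
  have \<beta>r: "0 < \<beta> * r"
    using \<beta>_pos r_pos by simp
  define dx where "dx k = ex k - (1 / (\<beta> * r)) *\<^sub>R \<zeta> k" for k
  have dxV: "dx k \<in> V" for k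
    by (simp add: dx_def)
  have comp: "(\<beta> * r) * ip (dx k) (dx k) \<le> ipG (d k) (d k)"
      "\<beta> * ip (ey k) (ey k) \<le> ipG (d k) (d k)" "(1 / \<beta>) * ip (el k) (el k) \<le> ipG (d k) (d k)" for k
    unfolding d_def dx_def[symmetric] by (intro ipG_components dxV errors_V)+
  note lim = direction_tendsto[OF sol]
  have dx: "(\<lambda>k. nrm (dx k)) \<longlonglongrightarrow> 0"
    by (rule nrm_tendsto_zeroI[OF dxV \<beta>r comp(1) lim])
  show ey: "(\<lambda>k. nrm (ey k)) \<longlonglongrightarrow> 0"
    by (rule nrm_tendsto_zeroI[OF errors_V(2) \<beta>_pos comp(2) lim])
  show "(\<lambda>k. nrm (el k)) \<longlonglongrightarrow> 0"
    by (rule nrm_tendsto_zeroI[OF errors_V(3) _ comp(3) lim]) (use \<beta>_pos in simp)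
  define q where "q = (L + \<beta>) / (\<beta> * r)"
  have q: "q < 1"
    using step_ratio by (simp add: q_def)
  have "nrm (ex k) \<le> nrm (dx k) / (1 - q)" for k
  proof -
    have "nrm (ex k) = nrm (dx k + (1 / (\<beta> * r)) *\<^sub>R \<zeta> k)"
      by (simp add: dx_def)
    also have "\<dots> \<le> nrm (dx k) + nrm ((1 / (\<beta> * r)) *\<^sub>R \<zeta> k)"
      using dxV by (intro nrm_triangle) simp_all
    also have "nrm ((1 / (\<beta> * r)) *\<^sub>R \<zeta> k) = nrm (\<zeta> k) / (\<beta> * r)"
      using \<beta>_pos r_pos by (simp add: nrm_scale)
    also have "\<dots> \<le> (L + \<beta>) * nrm (ex k) / (\<beta> * r)"
      using \<zeta>_bound \<beta>r by (intro divide_right_mono) simp_all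
    finally have "nrm (ex k) * (1 - q) \<le> nrm (dx k)"
      by (simp add: q_def right_diff_distrib mult.commute)
    then show ?thesis
      using q by (simp add: pos_le_divide_eq)
  qed
  then show ex: "(\<lambda>k. nrm (ex k)) \<longlonglongrightarrow> 0"
    by (rule nrm_tendsto_zero_le[OF errors_V(1)]) (rule tendsto_divide_zero[OF dx])
  have gb: "nrm (g k) \<le> (\<beta> * r + (L + \<beta>)) * nrm (ex k) + \<beta> * nrm (ey k)" for k
  proof -
    have "nrm (g k) \<le> nrm ((\<beta> * r) *\<^sub>R ex k) + nrm (\<zeta> k) + nrm (\<beta> *\<^sub>R ey k)"
      using nrm_triangle[of "(\<beta> * r) *\<^sub>R ex k - \<zeta> k" "\<beta> *\<^sub>R ey k"]
        nrm_triangle_diff[of "(\<beta> * r) *\<^sub>R ex k" "\<zeta> k"] by (simp add: g_def)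
    also have "nrm ((\<beta> * r) *\<^sub>R ex k) = (\<beta> * r) * nrm (ex k)"
      using \<beta>_pos r_pos by (simp add: nrm_scale)
    also have "nrm (\<beta> *\<^sub>R ey k) = \<beta> * nrm (ey k)"
      using \<beta>_pos by (simp add: nrm_scale)
    finally show ?thesis
      using \<zeta>_bound[of k] by (simp add: distrib_right)
  qed
  have "(\<lambda>k. (\<beta> * r + (L + \<beta>)) * nrm (ex k) + \<beta> * nrm (ey k)) \<longlonglongrightarrow> (\<beta> * r + (L + \<beta>)) * 0 + \<beta> * 0"
    by (intro tendsto_intros ex ey)
  then show "(\<lambda>k. nrm (g k)) \<longlonglongrightarrow> 0"
    by (intro nrm_tendsto_zero_le[OF errors_V(5) gb]) simp
qed

text \<open>These are the two sequences that the residual is paired with in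
  \<open>prediction_vi\<close>; bounded factors make the products vanish with the residual.\<close>

lemma predictions_bounded:
  assumes sol: "solution xs ys ls"
  shows "nrm_bounded xt" "nrm_bounded lt"
proof -
  have V: "xs \<in> V" "ys \<in> V" "ls \<in> V"
    using solution_V[OF sol] by auto
  have \<theta>: "\<theta> k - (xs, ys, ls) = (x k - xs, y k - ys, l k - ls)" for k
    by (simp add: \<theta>_def)
  define b where "b = ipG (\<theta> 0 - (xs, ys, ls)) (\<theta> 0 - (xs, ys, ls))"
  have comp: "(\<beta> * r) * ip (x k - xs) (x k - xs) \<le> b" "(1 / \<beta>) * ip (l k - ls) (l k - ls) \<le> b" for k
    using ipG_components[of "x k - xs" "y k - ys" "l k - ls"] distance_bounded[OF sol, of k] V
    unfolding b_def \<theta> by (meson V_diff iterates_V order_trans)+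
  have "nrm_bounded (\<lambda>k. x k - xs)" "nrm_bounded (\<lambda>k. l k - ls)"
    using nrm_boundedI[OF _ _ comp(1)] nrm_boundedI[OF _ _ comp(2)] V \<beta>_pos r_pos by simp_all
  moreover have "nrm_bounded ex" "nrm_bounded el"
    using ex_tendsto[OF sol] el_tendsto[OF sol] by (simp_all add: nrm_bounded_null)
  moreover have "nrm_bounded (\<lambda>k. - xs)" "nrm_bounded (\<lambda>k. - ls)"
    using V by (simp_all add: nrm_bounded_const)
  \<comment> \<open>The predictions are spelled as iterated differences to fit
    \<open>nrm_bounded_diff\<close>.\<close>
  ultimately have "nrm_bounded (\<lambda>k. x k - xs - ex k - (- xs))" "nrm_bounded (\<lambda>k. l k - ls - el k - (- ls))"
    using nrm_bounded_diff by blast+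
  then show "nrm_bounded xt" "nrm_bounded lt"
    by (simp_all add: ex_def el_def)
qed

section \<open>Weak cluster points and weak convergence of the iterates\<close>

lemma weak_components:
  assumes "G.wconv \<theta> (xs, ys, ls) H" and V: "xs \<in> V" "ys \<in> V" "ls \<in> V"
  shows "wconv x xs H" "wconv y ys H" "wconv l ls H"
proof -
  have lim: "((\<lambda>k. ipG (\<theta> k) (u, v, w)) \<longlongrightarrow> ipG (xs, ys, ls) (u, v, w)) H"
    if "u \<in> V" "v \<in> V" "w \<in> V" for u v w
    using assms(1) that unfolding G.wconv_def by (metis mem_Times_iff fst_conv snd_conv)
  show "wconv x xs H"
    unfolding wconv_def
  proof
    fix z
    assume "z \<in> V"
    then show "((\<lambda>k. ip (x k) z) \<longlongrightarrow> ip xs z) H"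
      using lim[of "(1 / (\<beta> * r)) *\<^sub>R z" 0 0] V \<beta>_pos r_pos by (simp add: \<theta>_def ip_scale_right)
  qed
  show "wconv y ys H"
    unfolding wconv_def
  proof
    fix z
    assume "z \<in> V"
    then show "((\<lambda>k. ip (y k) z) \<longlongrightarrow> ip ys z) H"
      using lim[of 0 "(1 / \<beta>) *\<^sub>R z" 0] V \<beta>_pos by (simp add: \<theta>_def ip_scale_right)
  qed
  show "wconv l ls H"
    unfolding wconv_def
  proof
    fix z
    assume "z \<in> V"
    then show "((\<lambda>k. ip (l k) z) \<longlongrightarrow> ip ls z) H"
      using lim[of 0 0 "\<beta> *\<^sub>R z"] V \<beta>_pos by (simp add: \<theta>_def ip_scale_right)
  qed
qed

text \<open>Iterates and predictions share their weak limits, and the predictions lie in the weakly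
  closed sets \<open>C\<close> and \<open>N\<close>, so the limit is feasible; \<open>Minty\<close>
  then needs only the inequality at fixed test points.\<close>

lemma weak_cluster_solution:
  assumes sol: "solution x0 y0 l0" and H: "H \<noteq> bot" "H \<le> sequentially"
    and V: "xs \<in> V" "ys \<in> V" "ls \<in> V" and w: "G.wconv \<theta> (xs, ys, ls) H"
  shows "solution xs ys ls"
proof -
  note lim = errors_tendsto[OF sol, THEN tendsto_mono[OF H(2)]]
  note comp = weak_components[OF w V]
  have wx: "wconv xt xs H"
    by (rule wconv_perturb[OF iterates_V(1) predictions_V(1) comp(1)]) (use lim(1) in \<open>simp add: ex_def\<close>)
  have wy: "wconv yt ys H"
    by (rule wconv_perturb[OF iterates_V(2) predictions_V(2) comp(2)]) (use lim(2) in \<open>simp add: ey_def\<close>)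
  have wl: "wconv lt ls H"
    by (rule wconv_perturb[OF iterates_V(3) predictions_V(3) comp(3)]) (use lim(3) in \<open>simp add: el_def\<close>)
  show ?thesis
  proof (rule Minty)
    show "xs \<in> C"
      by (rule closed_convex_imp_weakly_closed[OF C xt_C V(1) wx H(1)])
    show "ys \<in> N"
      by (rule closed_convex_imp_weakly_closed[OF N yt_N V(2) wy H(1)])
    show "ls \<in> V"
      by (rule V)
  next
    fix u v w
    assume uvw: "u \<in> C" "v \<in> N" "w \<in> V"
    have uV: "u \<in> V" "v \<in> V"
      using uvw C_V N_V by auto
    have lhs: "((\<lambda>k. ip (F u - w) (u - xt k) + ip w (v - yt k) + ip (u - v) (w - lt k)) \<longlongrightarrow>
        ip (F u - w) (u - xs) + ip w (v - ys) + ip (u - v) (w - ls)) H"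
      by (intro tendsto_add wconv_tendsto_diff wx wy wl V) (use uV uvw in simp_all)
    \<comment> \<open>Norm-null residuals paired with bounded sequences; no convergence of a product
      of two weakly convergent factors is involved.\<close>
    have rhs: "((\<lambda>k. ip (g k) (u - xt k) + ip (el k) (w - lt k) / \<beta>) \<longlongrightarrow> 0 + 0 / \<beta>) H"
      using \<beta>_pos uV uvw(3)
      by (intro tendsto_add tendsto_divide nrm_bounded_tendsto_ip tendsto_const nrm_bounded_diff
          nrm_bounded_const predictions_bounded[OF sol] lim errors_V) simp_all
    \<comment> \<open>Monotonicity replaces the operator at the prediction by the operator at
      \<open>(u, v, w)\<close>, which makes the right-hand side affine in the prediction.\<close>
    have "ip (g k) (u - xt k) + ip (el k) (w - lt k) / \<beta>
        \<le> ip (F u - w) (u - xt k) + ip w (v - yt k) + ip (u - v) (w - lt k)" for k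
      using prediction_vi[OF uvw, of k] operator_mono[of u v w "xt k" "yt k" "lt k"] uV uvw(3) by simp
    then show "0 \<le> ip (F u - w) (u - xs) + ip w (v - ys) + ip (u - v) (w - ls)"
      using tendsto_le[OF H(1) lhs rhs] by simp
  qed
qed

theorem weak_convergence:
  assumes sol: "solution x0 y0 l0"
  obtains xs ys ls where "solution xs ys ls"
    "wconv x xs sequentially" "wconv y ys sequentially" "wconv l ls sequentially"
proof -
  define S where "S = {(a, b, c). solution a b c}"
  define s where "s = (x0, y0, l0)"
  have sV: "s \<in> V \<times> V \<times> V"
    using solution_V[OF sol] by (simp add: s_def)
  have "\<exists>z\<in>S. G.wconv \<theta> z sequentially"
  proof (rule G.Opial)
    show "S \<subseteq> V \<times> V \<times> V"
      using solution_V by (auto simp: S_def)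
    show "G.nrm (\<theta> k) \<le> G.nrm (\<theta> 0 - s) + G.nrm s" for k
    proof -
      have "G.nrm (\<theta> k - s + s) \<le> G.nrm (\<theta> k - s) + G.nrm s"
        by (intro G.nrm_triangle G.V_diff \<theta>_V sV)
      also have "G.nrm (\<theta> k - s) \<le> G.nrm (\<theta> 0 - s)"
        using distance_bounded[OF sol, of k] unfolding s_def G.nrm_def by (rule real_sqrt_le_mono)
      finally show ?thesis
        by simp
    qed
    show "convergent (\<lambda>k. ipG (\<theta> k - z) (\<theta> k - z))" if "z \<in> S" for z
      using that convergent_distance by (auto simp: S_def)
    show "z \<in> S" if "H \<noteq> bot" "H \<le> sequentially" "z \<in> V \<times> V \<times> V" "G.wconv \<theta> z H" for H z
      using weak_cluster_solution[OF sol that(1,2)] that(3,4) by (auto simp: S_def)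
  qed (rule \<theta>_V)
  then obtain xs ys ls where "solution xs ys ls" "G.wconv \<theta> (xs, ys, ls) sequentially"
    by (auto simp: S_def)
  then show thesis
    using that weak_components solution_V by metis
qed

end

section \<open>Square-integrable random vectors\<close>

text \<open>Pointwise scaling, next to the pointwise addition of functions, lets \<open>L2 M\<close>
  serve as the subspace \<open>V\<close> of the abstract locales.\<close>

instantiation "fun" :: (type, real_vector) real_vector
begin

definition "c *\<^sub>R f = (\<lambda>x. c *\<^sub>R f x)"

instance
  by standard (simp_all add: scaleR_fun_def fun_eq_iff algebra_simps)

end

lemma scaleR_fun_apply [simp]: "(c *\<^sub>R f) x = c *\<^sub>R f x"
  by (simp add: scaleR_fun_def)

section \<open>Completeness of the space of square-integrable vectors\<close>

lemma L2_measurable [measurable_dest]: "x \<in> L2 M \<Longrightarrow> x \<in> borel_measurable M"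
  by (simp add: L2_def)

lemma L2_integrable_norm2: "x \<in> L2 M \<Longrightarrow> integrable M (\<lambda>\<omega>. (norm (x \<omega>))\<^sup>2)"
  by (simp add: L2_def)

lemma L2_inner_self: "L2_inner M x x = (\<integral>\<omega>. (norm (x \<omega>))\<^sup>2 \<partial>M)"
  by (simp add: L2_inner_def power2_norm_eq_inner)

lemma L2_bound:
  assumes [measurable]: "z \<in> borel_measurable M" and g: "integrable M g"
    and le: "\<And>\<omega>. (norm (z \<omega>))\<^sup>2 \<le> g \<omega>"
  shows "z \<in> L2 M"
proof -
  have "integrable M (\<lambda>\<omega>. (norm (z \<omega>))\<^sup>2)"
    by (rule Bochner_Integration.integrable_bound[OF g]) (use le in \<open>auto intro: order_trans[OF _ abs_ge_self]\<close>)
  then show ?thesis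
    by (simp add: L2_def)
qed

lemma L2_add:
  assumes "x \<in> L2 M" "y \<in> L2 M"
  shows "x + y \<in> L2 M"
proof (rule L2_bound)
  show "x + y \<in> borel_measurable M"
    unfolding plus_fun_def using assms by measurable
  show "integrable M (\<lambda>\<omega>. 2 * (norm (x \<omega>))\<^sup>2 + 2 * (norm (y \<omega>))\<^sup>2)"
    using assms by (simp add: L2_integrable_norm2)
  fix \<omega>
  have "(norm ((x + y) \<omega>))\<^sup>2 \<le> (norm (x \<omega>) + norm (y \<omega>))\<^sup>2"
    by (intro power_mono) (simp_all add: norm_triangle_ineq)
  also have "\<dots> \<le> 2 * (norm (x \<omega>))\<^sup>2 + 2 * (norm (y \<omega>))\<^sup>2"
    using sum_squares_bound[of "norm (x \<omega>)" "norm (y \<omega>)"] by (simp add: power2_sum)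
  finally show "(norm ((x + y) \<omega>))\<^sup>2 \<le> 2 * (norm (x \<omega>))\<^sup>2 + 2 * (norm (y \<omega>))\<^sup>2" .
qed

lemma L2_scale:
  assumes "x \<in> L2 M"
  shows "c *\<^sub>R x \<in> L2 M"
proof (rule L2_bound)
  show "c *\<^sub>R x \<in> borel_measurable M"
    unfolding scaleR_fun_def using assms by measurable
  show "integrable M (\<lambda>\<omega>. c\<^sup>2 * (norm (x \<omega>))\<^sup>2)"
    using assms by (simp add: L2_integrable_norm2)
qed (simp add: power_mult_distrib)

lemma subspace_L2: "subspace (L2 M)"
proof (rule subspaceI)
  show "0 \<in> L2 M"
    by (simp add: L2_def zero_fun_def)
qed (fact L2_add L2_scale)+

lemma integrable_L2_inner:
  assumes "x \<in> L2 M" "y \<in> L2 M"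
  shows "integrable M (\<lambda>\<omega>. x \<omega> \<bullet> y \<omega>)"
proof (rule Bochner_Integration.integrable_bound)
  show "integrable M (\<lambda>\<omega>. (norm (x \<omega>))\<^sup>2 + (norm (y \<omega>))\<^sup>2)"
    using assms by (simp add: L2_integrable_norm2)
  show "(\<lambda>\<omega>. x \<omega> \<bullet> y \<omega>) \<in> borel_measurable M"
    using assms by measurable
  have "norm (a \<bullet> b) \<le> norm ((norm a)\<^sup>2 + (norm b)\<^sup>2)" for a b :: 'b
  proof -
    have "norm (a \<bullet> b) \<le> norm a * norm b"
      by (simp add: Cauchy_Schwarz_ineq2)
    also have "\<dots> \<le> (norm a)\<^sup>2 + (norm b)\<^sup>2"
      using sum_squares_bound[of "norm a" "norm b"] mult_nonneg_nonneg[of "norm a" "norm b"]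
      by (simp del: mult_nonneg_nonneg)
    finally show ?thesis
      by simp
  qed
  then show "AE \<omega> in M. norm (x \<omega> \<bullet> y \<omega>) \<le> norm ((norm (x \<omega>))\<^sup>2 + (norm (y \<omega>))\<^sup>2)"
    by simp
qed

lemma (in finite_measure) L2_integrable_norm:
  assumes [measurable]: "x \<in> L2 M"
  shows "integrable M (\<lambda>\<omega>. norm (x \<omega>))"
  by (rule square_integrable_imp_integrable) (measurable, rule L2_integrable_norm2[OF assms])

text \<open>Pointwise, the norm is at most \<open>\<delta>\<close> or at most its square divided by
  \<open>\<delta>\<close>. This turns Cauchy sequences in mean square into Cauchy sequences in
  mean.\<close>

lemma (in finite_measure) L2_imp_L1_bound:
  assumes x: "x \<in> L2 M" and "0 < \<delta>"
  shows "(\<integral>\<omega>. norm (x \<omega>) \<partial>M) \<le> \<delta> * measure M (space M) + L2_inner M x x / \<delta>"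
proof -
  have "norm a \<le> \<delta> + (norm a)\<^sup>2 / \<delta>" for a :: 'b
  proof (cases "norm a \<le> \<delta>")
    case True
    then show ?thesis
      using \<open>0 < \<delta>\<close> by (smt (verit) divide_nonneg_pos zero_le_power2)
  next
    case False
    then have "norm a * \<delta> \<le> (norm a)\<^sup>2"
      unfolding power2_eq_square by (intro mult_left_mono) auto
    then show ?thesis
      using \<open>0 < \<delta>\<close> by (simp add: pos_le_divide_eq add_increasing)
  qed
  then have "(\<integral>\<omega>. norm (x \<omega>) \<partial>M) \<le> (\<integral>\<omega>. \<delta> + (norm (x \<omega>))\<^sup>2 / \<delta> \<partial>M)"
    using x by (intro integral_mono L2_integrable_norm) (simp_all add: L2_integrable_norm2)
  also have "\<dots> = \<delta> * measure M (space M) + L2_inner M x x / \<delta>"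
    using x by (simp add: L2_integrable_norm2 L2_inner_self mult.commute)
  finally show ?thesis .
qed

lemma nn_integral_L2:
  "x \<in> L2 M \<Longrightarrow> (\<integral>\<^sup>+\<omega>. ennreal ((norm (x \<omega>))\<^sup>2) \<partial>M) = ennreal (L2_inner M x x)"
  unfolding L2_inner_self by (intro nn_integral_eq_integral L2_integrable_norm2) simp_all

text \<open>Completeness is the Riesz-Fischer argument: a subsequence converges almost everywhere,
  and Fatou's lemma upgrades this to convergence of the whole sequence in mean square.\<close>

lemma (in finite_measure) semi_hilbert_L2:
  "semi_hilbert (L2 M :: ('a \<Rightarrow> 'v::euclidean_space) set) (L2_inner M)"
proof
  show "subspace (L2 M)"
    by (rule subspace_L2)
next
  fix x y z :: "'a \<Rightarrow> 'v" and c :: real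
  assume x: "x \<in> L2 M"
  show "0 \<le> L2_inner M x x"
    by (simp add: L2_inner_def)
  show "L2_inner M (c *\<^sub>R x) z = c * L2_inner M x z"
    by (simp add: L2_inner_def)
  assume y: "y \<in> L2 M"
  show "L2_inner M x y = L2_inner M y x"
    by (simp add: L2_inner_def inner_commute)
  assume "z \<in> L2 M"
  then show "L2_inner M (x + y) z = L2_inner M x z + L2_inner M y z"
    using x y by (simp add: L2_inner_def inner_add_left integrable_L2_inner)
next
  fix X :: "nat \<Rightarrow> 'a \<Rightarrow> 'v"
  assume X: "\<And>n. X n \<in> L2 M"
    and C: "\<And>e. 0 < e \<Longrightarrow> \<exists>k. \<forall>m\<ge>k. \<forall>n\<ge>k. L2_inner M (X m - X n) (X m - X n) < e"
  have [measurable]: "X n \<in> borel_measurable M" for n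
    using X by (rule L2_measurable)
  have D: "X m - X n \<in> L2 M" for m n
    using subspace_diff[OF subspace_L2 X X] .
  have [measurable]: "X m - X n \<in> borel_measurable M" for m n
    using D by (rule L2_measurable)
  obtain r where r: "strict_mono r" "AE \<omega> in M. Cauchy (\<lambda>i. X (r i) \<omega>)"
  proof (rule cauchy_L1_AE_cauchy_subseq)
    show "integrable M (X n)" for n
      using L2_integrable_norm[OF X] integrable_norm_iff[of "X n" M] by simp
    fix e :: real
    assume "0 < e"
    \<comment> \<open>Chosen so that the first term of \<open>L2_imp_L1_bound\<close> stays below
      \<open>e / 2\<close>; the added 1 keeps the denominator positive and the bound strict.\<close>
    define \<delta> where "\<delta> = e / (2 * (measure M (space M) + 1))"
    have m: "0 < measure M (space M) + 1"
      by (simp add: add_nonneg_pos)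
    have \<delta>: "0 < \<delta>"
      using \<open>0 < e\<close> m by (simp add: \<delta>_def)
    have "\<delta> * (measure M (space M) + 1) = e / 2"
      using m by (simp add: \<delta>_def field_simps)
    then have \<delta>e: "\<delta> * measure M (space M) < e / 2"
      using \<delta> by (simp add: distrib_left)
    obtain k where k: "\<forall>m\<ge>k. \<forall>n\<ge>k. L2_inner M (X m - X n) (X m - X n) < \<delta> * (e / 2)"
      using C[of "\<delta> * (e / 2)"] \<delta> \<open>0 < e\<close> by auto
    have "(\<integral>\<omega>. norm (X i \<omega> - X j \<omega>) \<partial>M) < e" if "i \<ge> k" "j \<ge> k" for i j
    proof -
      have "L2_inner M (X i - X j) (X i - X j) / \<delta> < e / 2"
        using k that \<delta> by (simp add: pos_divide_less_eq mult.commute)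
      then show ?thesis
        using L2_imp_L1_bound[OF D \<delta>, of i j] \<delta>e unfolding minus_apply by linarith
    qed
    then show "\<exists>k. \<forall>i\<ge>k. \<forall>j\<ge>k. (\<integral>\<omega>. norm (X i \<omega> - X j \<omega>) \<partial>M) < e"
      by blast
  qed
  \<comment> \<open>Where the subsequence diverges, \<open>lim\<close> has one fixed value, so
    \<open>f\<close> is measurable everywhere although it is a limit only almost everywhere.\<close>
  define f where "f \<omega> = lim (\<lambda>i. X (r i) \<omega>)" for \<omega>
  have [measurable]: "f \<in> borel_measurable M"
    unfolding f_def[abs_def] by measurable
  have [measurable]: "X n - f \<in> borel_measurable M" for n
    unfolding fun_diff_def by measurable
  have f: "AE \<omega> in M. (\<lambda>i. X (r i) \<omega>) \<longlonglongrightarrow> f \<omega>"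
    using r(2) by eventually_elim (simp add: f_def convergent_LIMSEQ_iff[symmetric] Cauchy_convergent_iff)
  \<comment> \<open>Used twice: for some finite bound it puts \<open>f\<close> into
    \<open>L2 M\<close>, and for small bounds it gives convergence.\<close>
  have Fatou: "(\<integral>\<^sup>+\<omega>. ennreal ((norm ((X n - f) \<omega>))\<^sup>2) \<partial>M) \<le> ennreal e"
    if k: "\<forall>m\<ge>k. \<forall>n\<ge>k. L2_inner M (X m - X n) (X m - X n) < e" and n: "n \<ge> k" for k n e
  proof -
    have "(\<integral>\<^sup>+\<omega>. ennreal ((norm ((X n - f) \<omega>))\<^sup>2) \<partial>M)
        = (\<integral>\<^sup>+\<omega>. liminf (\<lambda>i. ennreal ((norm ((X n - X (r i)) \<omega>))\<^sup>2)) \<partial>M)"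
    proof (rule nn_integral_cong_AE, use f in eventually_elim)
      fix \<omega>
      assume "(\<lambda>i. X (r i) \<omega>) \<longlonglongrightarrow> f \<omega>"
      then have "(\<lambda>i. ennreal ((norm ((X n - X (r i)) \<omega>))\<^sup>2)) \<longlonglongrightarrow> ennreal ((norm ((X n - f) \<omega>))\<^sup>2)"
        by (auto intro!: tendsto_intros)
      then show "ennreal ((norm ((X n - f) \<omega>))\<^sup>2) = liminf (\<lambda>i. ennreal ((norm ((X n - X (r i)) \<omega>))\<^sup>2))"
        by (rule lim_imp_Liminf[OF sequentially_bot, symmetric])
    qed
    also have "\<dots> \<le> liminf (\<lambda>i. \<integral>\<^sup>+\<omega>. ennreal ((norm ((X n - X (r i)) \<omega>))\<^sup>2) \<partial>M)"
      by (intro nn_integral_liminf) measurable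
    also have "\<dots> \<le> ennreal e"
    proof (rule Liminf_le)
      show "\<forall>\<^sub>F i in sequentially. (\<integral>\<^sup>+\<omega>. ennreal ((norm ((X n - X (r i)) \<omega>))\<^sup>2) \<partial>M) \<le> ennreal e"
        using eventually_ge_at_top[of k]
      proof eventually_elim
        case (elim i)
        then have "k \<le> r i"
          using seq_suble[OF r(1), of i] by simp
        then show ?case
          using k n by (simp only: nn_integral_L2[OF D]) (simp add: ennreal_leI less_imp_le)
      qed
    qed simp
    finally show ?thesis .
  qed
  have diff: "X n - f \<in> L2 M" if "\<forall>m\<ge>k. \<forall>n\<ge>k. L2_inner M (X m - X n) (X m - X n) < e" "n \<ge> k" for k n e
  proof -
    have "integrable M (\<lambda>\<omega>. (norm ((X n - f) \<omega>))\<^sup>2)"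
    proof (rule integrableI_bounded)
      show "(\<integral>\<^sup>+\<omega>. ennreal (norm ((norm ((X n - f) \<omega>))\<^sup>2)) \<partial>M) < \<infinity>"
        using le_less_trans[OF Fatou[OF that] ennreal_less_top] by simp
    qed measurable
    then show ?thesis
      by (rule L2_bound[rotated]) simp_all
  qed
  have f_L2: "f \<in> L2 M"
  proof -
    obtain k where "\<forall>m\<ge>k. \<forall>n\<ge>k. L2_inner M (X m - X n) (X m - X n) < 1"
      using C[of 1] by auto
    then have "X k - (X k - f) \<in> L2 M"
      by (intro subspace_diff[OF subspace_L2] X diff) auto
    then show ?thesis
      by simp
  qed
  show "\<exists>x\<in>L2 M. (\<lambda>n. L2_inner M (X n - x) (X n - x)) \<longlonglongrightarrow> 0"
  proof (intro bexI[OF _ f_L2] LIMSEQ_I)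
    fix e :: real
    assume "0 < e"
    then obtain k where k: "\<forall>m\<ge>k. \<forall>n\<ge>k. L2_inner M (X m - X n) (X m - X n) < e / 2"
      using C[of "e / 2"] by auto
    have "norm (L2_inner M (X n - f) (X n - f) - 0) < e" if "n \<ge> k" for n
    proof -
      have "L2_inner M (X n - f) (X n - f) \<le> e / 2"
        using Fatou[OF k that] nn_integral_L2[OF diff[OF k that]] \<open>0 < e\<close> by (simp add: ennreal_le_iff)
      moreover have "0 \<le> L2_inner M (X n - f) (X n - f)"
        by (simp add: L2_inner_def)
      ultimately show ?thesis
        using \<open>0 < e\<close> by simp
    qed
    then show "\<exists>k. \<forall>n\<ge>k. norm (L2_inner M (X n - f) (X n - f) - 0) < e"
      by blast
  qed
qed

text \<open>Convergence in mean square is convergence in mean of the squared distances. The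
  subsequence lets constraints that hold pointwise pass to limits.\<close>

lemma L2_tendsto_AE_subseq:
  assumes X: "\<And>n. X n \<in> L2 M" and x: "x \<in> L2 M"
    and lim: "(\<lambda>n. L2_inner M (X n - x) (X n - x)) \<longlonglongrightarrow> 0"
  obtains r :: "nat \<Rightarrow> nat" where "AE \<omega> in M. (\<lambda>k. X (r k) \<omega>) \<longlonglongrightarrow> x \<omega>"
proof -
  have D: "X n - x \<in> L2 M" for n
    by (rule subspace_diff[OF subspace_L2 X x])
  obtain r :: "nat \<Rightarrow> nat" where "AE \<omega> in M. (\<lambda>k. (norm ((X (r k) - x) \<omega>))\<^sup>2) \<longlonglongrightarrow> 0"
    using tendsto_L1_AE_subseq[of M "\<lambda>n \<omega>. (norm ((X n - x) \<omega>))\<^sup>2"] L2_integrable_norm2[OF D] lim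
    by (auto simp: L2_inner_self)
  then have "AE \<omega> in M. (\<lambda>k. X (r k) \<omega>) \<longlonglongrightarrow> x \<omega>"
  proof eventually_elim
    case (elim \<omega>)
    then have "(\<lambda>k. norm (X (r k) \<omega> - x \<omega>)) \<longlonglongrightarrow> 0"
      using tendsto_real_sqrt[OF elim] by simp
    then show ?case
      by (simp add: tendsto_norm_zero_iff LIM_zero_iff)
  qed
  then show thesis
    using that by blast
qed

section \<open>The constraint and nonanticipativity sets are closed and convex\<close>

lemma stage_part_add: "stage_part stg i (u + v) = stage_part stg i u + stage_part stg i v"
  and stage_part_scale: "stage_part stg i (c *\<^sub>R u) = c *\<^sub>R stage_part stg i u"
  by (simp_all add: stage_part_def vec_eq_iff)

lemma tendsto_stage_part:
  "(f \<longlongrightarrow> v) H \<Longrightarrow> ((\<lambda>k. stage_part stg i (f k)) \<longlongrightarrow> stage_part stg i v) H"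
  unfolding stage_part_def by (intro vec_tendstoI) (simp add: tendsto_vec_nth)

text \<open>Everything happens pointwise: countably many exceptional null sets are merged into one,
  and outside it each \<open>C i \<omega>\<close> is closed and convex.\<close>

lemma (in finite_measure) closed_convex_constraint_set:
  assumes "\<And>i \<omega>. i < N \<Longrightarrow> \<omega> \<in> space M \<Longrightarrow> closed (C i \<omega>) \<and> convex (C i \<omega>)"
  shows "semi_hilbert.closed_convex (L2 M) (L2_inner M) (constraint_set M N stg C)"
proof -
  interpret semi_hilbert "L2 M" "L2_inner M :: ('a \<Rightarrow> real^'b) \<Rightarrow> _"
    by (rule semi_hilbert_L2)
  show ?thesis
  proof (rule closed_convexI)
    show "constraint_set M N stg C \<subseteq> L2 M"
      by (auto simp: constraint_set_def)
  next
    fix x y and t :: real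
    assume x: "x \<in> constraint_set M N stg C" and y: "y \<in> constraint_set M N stg C" and t: "0 \<le> t" "t \<le> 1"
    have "AE \<omega> in M. stage_part stg i (((1 - t) *\<^sub>R x + t *\<^sub>R y) \<omega>) \<in> C i \<omega>" if "i < N" for i
    proof -
      have "AE \<omega> in M. stage_part stg i (x \<omega>) \<in> C i \<omega>" "AE \<omega> in M. stage_part stg i (y \<omega>) \<in> C i \<omega>"
        using x y that by (auto simp: constraint_set_def)
      then show ?thesis
        using AE_space
      proof eventually_elim
        case (elim \<omega>)
        then show ?case
          using assms[OF that elim(3)] t by (simp add: stage_part_add stage_part_scale convex_alt)
      qed
    qed
    then show "(1 - t) *\<^sub>R x + t *\<^sub>R y \<in> constraint_set M N stg C"
      using x y by (simp add: constraint_set_def)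
  next
    fix X x
    assume X: "\<And>n. X n \<in> constraint_set M N stg C" and x: "x \<in> L2 M"
      and lim: "(\<lambda>n. L2_inner M (X n - x) (X n - x)) \<longlonglongrightarrow> 0"
    obtain r :: "nat \<Rightarrow> nat" where r: "AE \<omega> in M. (\<lambda>k. X (r k) \<omega>) \<longlonglongrightarrow> x \<omega>"
      by (rule L2_tendsto_AE_subseq[OF _ x lim]) (use X in \<open>auto simp: constraint_set_def\<close>)
    have "AE \<omega> in M. stage_part stg i (x \<omega>) \<in> C i \<omega>" if "i < N" for i
    proof -
      have "AE \<omega> in M. \<forall>n. stage_part stg i (X n \<omega>) \<in> C i \<omega>"
        using X that by (auto simp: constraint_set_def AE_all_countable)
      then show ?thesis
        using r AE_space
      proof eventually_elim
        case (elim \<omega>)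
        then show ?case
          using assms[OF that elim(3)] tendsto_stage_part[OF elim(2), of stg i]
            closed_sequentially[of "C i \<omega>" "\<lambda>k. stage_part stg i (X (r k) \<omega>)"] by blast
      qed
    qed
    then show "x \<in> constraint_set M N stg C"
      using x by (simp add: constraint_set_def)
  qed
qed

text \<open>The work is on the measurable representatives rather than on the vectors themselves,
  since a limit of representatives is again measurable for the stage field.\<close>

lemma (in finite_measure) closed_convex_nonanticipative:
  "semi_hilbert.closed_convex (L2 M) (L2_inner M) (nonanticipative M m \<xi> N stg)"
proof -
  interpret semi_hilbert "L2 M" "L2_inner M :: ('a \<Rightarrow> real^'b) \<Rightarrow> _"
    by (rule semi_hilbert_L2)
  let ?N = "nonanticipative M m \<xi> N stg"
  show ?thesis
  proof (rule closed_convexI)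
    show "?N \<subseteq> L2 M"
      by (auto simp: nonanticipative_def)
  next
    fix x y and t :: real
    assume x: "x \<in> ?N" and y: "y \<in> ?N"
    have "\<exists>z\<in>borel_measurable (stage_field M m \<xi> i).
        AE \<omega> in M. stage_part stg i (((1 - t) *\<^sub>R x + t *\<^sub>R y) \<omega>) = z \<omega>" if i: "i < N" for i
    proof -
      obtain u where u: "u \<in> borel_measurable (stage_field M m \<xi> i)" "AE \<omega> in M. stage_part stg i (x \<omega>) = u \<omega>"
        using x i by (auto simp: nonanticipative_def)
      obtain v where v: "v \<in> borel_measurable (stage_field M m \<xi> i)" "AE \<omega> in M. stage_part stg i (y \<omega>) = v \<omega>"
        using y i by (auto simp: nonanticipative_def)
      have "(\<lambda>\<omega>. (1 - t) *\<^sub>R u \<omega> + t *\<^sub>R v \<omega>) \<in> borel_measurable (stage_field M m \<xi> i)"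
        using u(1) v(1) by measurable
      moreover have "AE \<omega> in M. stage_part stg i (((1 - t) *\<^sub>R x + t *\<^sub>R y) \<omega>) = (1 - t) *\<^sub>R u \<omega> + t *\<^sub>R v \<omega>"
        using u(2) v(2) by eventually_elim (simp add: stage_part_add stage_part_scale)
      ultimately show ?thesis
        by (intro bexI[of _ "\<lambda>\<omega>. (1 - t) *\<^sub>R u \<omega> + t *\<^sub>R v \<omega>"])
    qed
    then show "(1 - t) *\<^sub>R x + t *\<^sub>R y \<in> ?N"
      using x y by (simp add: nonanticipative_def)
  next
    fix X x
    assume X: "\<And>n. X n \<in> ?N" and x: "x \<in> L2 M"
      and lim: "(\<lambda>n. L2_inner M (X n - x) (X n - x)) \<longlonglongrightarrow> 0"
    obtain r :: "nat \<Rightarrow> nat" where r: "AE \<omega> in M. (\<lambda>k. X (r k) \<omega>) \<longlonglongrightarrow> x \<omega>"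
      by (rule L2_tendsto_AE_subseq[OF _ x lim]) (use X in \<open>auto simp: nonanticipative_def\<close>)
    have "\<exists>z\<in>borel_measurable (stage_field M m \<xi> i). AE \<omega> in M. stage_part stg i (x \<omega>) = z \<omega>"
      if i: "i < N" for i
    proof -
      have "\<forall>n. \<exists>z. z \<in> borel_measurable (stage_field M m \<xi> i) \<and> (AE \<omega> in M. stage_part stg i (X n \<omega>) = z \<omega>)"
        using X i unfolding nonanticipative_def by blast
      then obtain z where z: "\<And>n. z n \<in> borel_measurable (stage_field M m \<xi> i)"
          "\<And>n. AE \<omega> in M. stage_part stg i (X n \<omega>) = z n \<omega>"
        by metis
      \<comment> \<open>This limit is measurable for the stage field at every point, convergent or
        not. That matters for stage 0, where a change on a null set could destroy
        measurability.\<close>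
      have "(\<lambda>\<omega>. lim (\<lambda>k. z (r k) \<omega>)) \<in> borel_measurable (stage_field M m \<xi> i)"
        by (intro borel_measurable_lim_metric z)
      moreover have "AE \<omega> in M. \<forall>n. stage_part stg i (X n \<omega>) = z n \<omega>"
        using z(2) by (simp add: AE_all_countable)
      with r have "AE \<omega> in M. stage_part stg i (x \<omega>) = lim (\<lambda>k. z (r k) \<omega>)"
      proof eventually_elim
        case (elim \<omega>)
        then show ?case
          using limI[OF tendsto_stage_part[OF elim(1), of stg i]] by simp
      qed
      ultimately show ?thesis
        by (intro bexI[of _ "\<lambda>\<omega>. lim (\<lambda>k. z (r k) \<omega>)"])
    qed
    then show "x \<in> ?N"
      using x by (simp add: nonanticipative_def)
  qed
qed


section \<open>Instantiation for square-integrable random vectors\<close>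

theorem theorem3p2:
  fixes M :: "'a measure"
    and N :: nat
    and m :: "nat \<Rightarrow> nat"
    and \<xi> :: "nat \<Rightarrow> 'a \<Rightarrow> nat \<Rightarrow> real"
    and stg :: "'n::finite \<Rightarrow> nat"
    and C :: "nat \<Rightarrow> 'a \<Rightarrow> (real^'n) set"
    and F :: "('a \<Rightarrow> real^'n) \<Rightarrow> ('a \<Rightarrow> real^'n)"
    and L\<^sub>F \<beta> r \<alpha> :: real
    and \<theta>0 :: "('a, real^'n) triple"
  defines "CC \<equiv> constraint_set M N stg C"
    and "NN \<equiv> nonanticipative M m \<xi> N stg"
  defines "K \<equiv> CC \<times> NN \<times> L2 M"
  assumes "prob_space M" and "complete_measure M"
    and "\<And>j. 1 \<le> j \<Longrightarrow> j < N \<Longrightarrow> \<xi> j \<in> measurable M (Pi\<^sub>M {..<m j} (\<lambda>_. borel))"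
    and "\<And>c. stg c < N"
    and "\<And>i. i < N \<Longrightarrow> measurable_set_map (stage_field M m \<xi> i) stg i (C i)"
    and "\<And>i \<omega>. i < N \<Longrightarrow> \<omega> \<in> space M \<Longrightarrow>
           C i \<omega> \<subseteq> stage_space stg i \<and> C i \<omega> \<noteq> {} \<and> closed (C i \<omega>) \<and> convex (C i \<omega>)"
    and "\<And>x. x \<in> L2 M \<Longrightarrow> F x \<in> L2 M"
    and "L2_monotone M F"
    and "L\<^sub>F > 0" and "L2_lipschitz M L\<^sub>F F"
    and "\<exists>\<theta>. VI_solution M (VI_operator F) K \<theta>"
    and "\<beta> > 0" and "r > L\<^sub>F / \<beta> + 1" and "0 < \<alpha>" and "\<alpha> < 1"
    and "\<theta>0 \<in> CC \<times> NN \<times> L2 M"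
  shows "\<exists>\<theta>'. VI_solution M (VI_operator F) K \<theta>' \<and>
           weakly_converges3 M (ADMM M F CC NN \<beta> r \<alpha> \<theta>0) \<theta>'"
proof -
  interpret prob_space M
    by fact
  interpret H: semi_hilbert "L2 M" "L2_inner M :: ('a \<Rightarrow> real^'n) \<Rightarrow> _"
    by (rule semi_hilbert_L2)
  have nrm: "H.nrm = L2_norm M"
    by (simp add: H.nrm_def[abs_def] L2_norm_def[abs_def])
  \<comment> \<open>Both choices range over literally the same predicate, so the operators are equal
    as functions, not merely almost surely.\<close>
  have proj: "H.proj = L2_proj M"
    by (simp add: H.proj_def[abs_def] L2_proj_def[abs_def] nrm fun_diff_def)
  interpret VI: splitting_vi "L2 M" "L2_inner M" CC NN F L\<^sub>F \<beta> r
  proof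
    show "H.closed_convex CC" "H.closed_convex NN"
      unfolding CC_def NN_def using assms(9)
      by (intro closed_convex_constraint_set closed_convex_nonanticipative; blast)+
    show "0 \<le> L2_inner M (F x - F y) (x - y)" if "x \<in> L2 M" "y \<in> L2 M" for x y
      using \<open>L2_monotone M F\<close> that by (simp add: L2_monotone_def fun_diff_def)
    show "H.nrm (F x - F y) \<le> L\<^sub>F * H.nrm (x - y)" if "x \<in> L2 M" "y \<in> L2 M" for x y
      using \<open>L2_lipschitz M L\<^sub>F F\<close> that by (simp add: L2_lipschitz_def nrm fun_diff_def)
  qed (use assms in auto)
  have VI: "VI_solution M (VI_operator F) K (x, y, l) \<longleftrightarrow> VI.solution x y l" for x y l
    by (auto simp: VI_solution_def VI.solution_def K_def fun_diff_def)
  define \<theta> where \<theta>_ADMM: "\<theta> = ADMM M F CC NN \<beta> r \<alpha> \<theta>0"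
  define \<theta>t where "\<theta>t k = prediction M F CC NN \<beta> r (\<theta> k)" for k
  define x y l where "x k = fst (\<theta> k)" and "y k = fst (snd (\<theta> k))" and "l k = snd (snd (\<theta> k))" for k
  define xt yt lt where "xt k = fst (\<theta>t k)" and "yt k = fst (snd (\<theta>t k))" and "lt k = snd (snd (\<theta>t k))" for k
  have \<theta>: "\<theta> k = (x k, y k, l k)" for k
    by (simp add: x_def y_def l_def)
  have \<theta>t: "\<theta>t k = (xt k, yt k, lt k)" for k
    by (simp add: xt_def yt_def lt_def)
  have pred: "xt k = H.proj CC (x k - (1 / (\<beta> * r)) *\<^sub>R (F (x k) - l k + \<beta> *\<^sub>R (x k - y k)))"
    "yt k = H.proj NN (y k - (1 / \<beta>) *\<^sub>R (l k - \<beta> *\<^sub>R (xt k - y k)))"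
    "lt k = l k - \<beta> *\<^sub>R (xt k - yt k)" for k
    using \<theta>t_def[of k] unfolding \<theta> \<theta>t
    by (simp_all add: Let_def proj fun_diff_def plus_fun_def scaleR_fun_def)
  have "\<theta> (Suc k) = diff3 (\<theta> k) (scale3 \<alpha> (direction \<beta> r (\<theta> k) (\<theta>t k) (zeta F \<beta> (\<theta> k) (\<theta>t k))))" for k
    by (simp add: \<theta>_ADMM \<theta>t_def Let_def)
  then have step: "x (Suc k) = x k - \<alpha> *\<^sub>R
      (x k - xt k - (1 / (\<beta> * r)) *\<^sub>R (F (x k) - F (xt k) + \<beta> *\<^sub>R (x k - xt k)))"
    "y (Suc k) = y k - \<alpha> *\<^sub>R (y k - yt k)" "l (Suc k) = l k - \<alpha> *\<^sub>R (l k - lt k)" for k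
    unfolding \<theta> \<theta>t by (simp_all add: direction_def fun_diff_def plus_fun_def scaleR_fun_def)
  have start: "(x 0, y 0, l 0) = \<theta>0"
    using \<theta>[of 0] by (simp add: \<theta>_ADMM)
  obtain x0 y0 l0 where sol: "VI.solution x0 y0 l0"
    using assms(14) VI by (metis prod_cases3)
  interpret admm "L2 M" "L2_inner M" CC NN F L\<^sub>F \<beta> r \<alpha> x y l xt yt lt
  proof
    \<comment> \<open>Nonemptiness is read off the solution that is assumed to exist.\<close>
    show "CC \<noteq> {}" "NN \<noteq> {}"
      using sol by (auto simp: VI.solution_def)
    show "x 0 \<in> L2 M" "y 0 \<in> L2 M" "l 0 \<in> L2 M"
      using assms(19) VI.C_V VI.N_V by (auto simp flip: start)
  qed (fact assms pred step)+
  obtain xs ys ls where s: "VI.solution xs ys ls" "H.wconv x xs sequentially"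
      "H.wconv y ys sequentially" "H.wconv l ls sequentially"
    using weak_convergence[OF sol] .
  \<comment> \<open>Componentwise weak limits add up because the unweighted form on triples is a
    sum.\<close>
  have "weakly_converges3 M \<theta> (xs, ys, ls)"
    using s(2-4) VI.solution_V[OF s(1)] iterates_V
    by (auto simp: weakly_converges3_def \<theta> H.wconv_def intro!: tendsto_add)
  moreover have "VI_solution M (VI_operator F) K (xs, ys, ls)"
    using s(1) by (simp only: VI)
  ultimately show ?thesis
    unfolding \<theta>_ADMM[symmetric] by (intro exI[of _ "(xs, ys, ls)"] conjI)
qed

end
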